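(* Let $\mathcal{H}$ be a complex Hilbert space and let $D$ be a bounded open convex subset of $\mathbb{C}$ with a regular analytic boundary curve. Suppose that $W(A) \subseteq \overline{D}$ and $W_{\mathrm{ess}}(A) \subset D$ for some $A \in \mathcal{B}(\mathcal{H})$. If $\overline{W(A)}$ intersects $\partial D$ at infinitely many points, then $W(A) = \overline{D}$.
   Context: $\mathcal{B}(\mathcal{H})$ denotes the set of bounded linear operators on the complex Hilbert space $\mathcal{H}$ (finite or infinite dimensional), and $S_{\mathcal{H}}$ denotes the unit sphere of $\mathcal{H}$. The numerical range of $A \in \mathcal{B}(\mathcal{H})$ is $W(A) := \{\langle Ax, x\rangle : x \in S_{\mathcal{H}}\} \subseteq \mathbb{C}$. The essential numerical range of $A$ is $W_{\mathrm{ess}}(A) := \bigcap_{K} \overline{W(A+K)}$, where the intersection is taken over all compact operators $K \in \mathcal{B}(\mathcal{H})$; in particular $W_{\mathrm{ess}}(A) = \varnothing$ when $\mathcal{H}$ is finite dimensional. Overlines denote closures in $\mathbb{C}$, and $\partial D$ is the boundary of $D$ in $\mathbb{C}$. A curve is analytic if it is the range of an analytic function $\gamma$ from an interval $I \subseteq \mathbb{R}$ into $\mathbb{C}$; it is regular if $\gamma'(t) \neq 0$ for all $t \in I$.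
   Formalization: The interval I parametrizing the regular analytic boundary curve is taken nondegenerate and either open or compact; for half-open I the claim as stated is false, since analyticity may fail at the point where the curve closes up. *)

theory Defs
  imports "HOL-Analysis.Analysis"
begin

(* Complex Hilbert spaces of arbitrary (finite or infinite) dimension. The inner product is
   linear in its first argument; the norm and topology are those of the underlying real
   Hilbert space, i.e. norm x = sqrt (Re (cinner x x)). *)
class complex_hilbert = real_inner + complete_space +
  fixes scaleC :: "complex \<Rightarrow> 'a \<Rightarrow> 'a" (infixr "*\<^sub>C" 75)
    and cinner :: "'a \<Rightarrow> 'a \<Rightarrow> complex"
  assumes scaleC_add_right: "c *\<^sub>C (x + y) = c *\<^sub>C x + c *\<^sub>C y"
    and scaleC_add_left: "(c + d) *\<^sub>C x = c *\<^sub>C x + d *\<^sub>C x"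
    and scaleC_scaleC: "c *\<^sub>C d *\<^sub>C x = (c * d) *\<^sub>C x"
    and scaleR_scaleC: "r *\<^sub>R x = complex_of_real r *\<^sub>C x"
    and cinner_commute: "cinner x y = cnj (cinner y x)"
    and cinner_add_left: "cinner (x + y) z = cinner x z + cinner y z"
    and cinner_scaleC_left: "cinner (c *\<^sub>C x) y = c * cinner x y"
    and inner_eq_Re_cinner: "x \<bullet> y = Re (cinner x y)"

instantiation complex :: complex_hilbert
begin

definition scaleC_complex :: "complex \<Rightarrow> complex \<Rightarrow> complex"
  where "scaleC_complex c x = c * x"

definition cinner_complex :: "complex \<Rightarrow> complex \<Rightarrow> complex"
  where "cinner_complex x y = x * cnj y"

instance
  by standard
    (auto simp: scaleC_complex_def cinner_complex_def inner_complex_def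
      scaleR_conv_of_real algebra_simps)

end

definition bounded_clinear :: "('a::complex_hilbert \<Rightarrow> 'a) \<Rightarrow> bool"
  where "bounded_clinear A \<longleftrightarrow> bounded_linear A \<and> (\<forall>c x. A (c *\<^sub>C x) = c *\<^sub>C A x)"

definition compact_operator :: "('a::complex_hilbert \<Rightarrow> 'a) \<Rightarrow> bool"
  where "compact_operator K \<longleftrightarrow> bounded_clinear K \<and> compact (closure (K ` cball 0 1))"

definition numerical_range :: "('a::complex_hilbert \<Rightarrow> 'a) \<Rightarrow> complex set"
  where "numerical_range A = (\<lambda>x. cinner (A x) x) ` sphere 0 1"

definition essential_numerical_range :: "('a::complex_hilbert \<Rightarrow> 'a) \<Rightarrow> complex set"
  where "essential_numerical_range A =
    (\<Inter>K\<in>{K. compact_operator K}. closure (numerical_range (\<lambda>x. A x + K x)))"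

(* At an endpoint of I belonging to I the expansion is one-sided, which amounts to the existence
   of an analytic extension beyond the endpoint. *)
definition real_analytic_on :: "(real \<Rightarrow> complex) \<Rightarrow> real set \<Rightarrow> bool"
  where "real_analytic_on \<gamma> I \<longleftrightarrow>
    (\<forall>t\<^sub>0\<in>I. \<exists>r>0. \<exists>c. \<forall>t\<in>I. \<bar>t - t\<^sub>0\<bar> < r \<longrightarrow> (\<lambda>n. c n * of_real (t - t\<^sub>0) ^ n) sums \<gamma> t)"

(* The parameter interval is nondegenerate, so that derivatives make sense, and either open
   (possibly unbounded) or compact. Half-open intervals must be excluded for boundary curves:
   with D = {\<rho> exp(it) | 0 \<le> \<rho> < R(t), 0 < t \<le> 2 pi},
   R(t) = 1 + \<epsilon> (2 pi - t)^2 exp(-1/t) sin(1/t)^2 and \<epsilon> > 0 small, the boundary of the convex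
   domain D is the range of a regular analytic function on the interval {0<..2 pi} and meets
   the closed unit disc, a numerical range, infinitely often near 1 although D is not the
   disc. *)
definition regular_analytic_curve :: "complex set \<Rightarrow> bool"
  where "regular_analytic_curve C \<longleftrightarrow>
    (\<exists>I \<gamma>. is_interval I \<and> interior I \<noteq> {} \<and> (open I \<or> compact I) \<and>
      real_analytic_on \<gamma> I \<and> (\<forall>t\<in>I. vector_derivative \<gamma> (at t within I) \<noteq> 0) \<and>
      C = \<gamma> ` I)"

end

theory Submission
  imports Defs "HOL-Complex_Analysis.Complex_Analysis" "Jordan_Normal_Form.Determinant"
begin

text \<open>
  Let \<open>\<gamma>\<close> parametrize the boundary of \<open>D\<close> and let \<open>n t\<close> be the outer normal at \<open>\<gamma> t\<close> given by
  the rotated tangent. The Hermitian forms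
  \<open>b t x x = Re (cnj (n t) * (\<langle>A x, x\<rangle> - \<gamma> t * \<parallel>x\<parallel>\<^sup>2))\<close> are negative semidefinite and analytic in \<open>t\<close>,
  also where the curvature vanishes and the support function of \<open>D\<close> is not analytic. Since the
  essential numerical range lies in \<open>D\<close>, each \<open>b t\<close> is negative definite modulo finite rank, so
  that near every parameter the degeneracy of \<open>b t\<close> is the vanishing of a holomorphic determinant. A
  boundary point \<open>\<gamma> t\<close> in the closure of \<open>W(A)\<close> makes \<open>b t\<close> degenerate. Infinitely many of
  these have a limit parameter, so \<open>b t\<close> is degenerate for all \<open>t\<close>. A null vector of \<open>b t\<close> yields a
  point of \<open>W(A)\<close> on the supporting line at \<open>\<gamma> t\<close>, which is \<open>\<gamma> t\<close> by strict convexity. Hence \<open>W(A)\<close>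
  contains the boundary of \<open>D\<close>, and it is convex.
\<close>


text \<open>The largest spectral value of \<open>b t\<close> need not be analytic in
  \<open>t\<close>, because eigenvalue branches may cross; the determinant only records whether some
  branch vanishes. It is available near one parameter at a time, since the compensating finite-rank
  projection is chosen there. Degeneracy therefore spreads along \<open>I\<close> through the set of
  limit parameters, which is open and closed in \<open>I\<close>. Negative definiteness modulo
  finite rank is used a second time: it makes the value 0 of \<open>b t\<close> attained on the unit
  sphere as soon as it is approached, so that boundary points in the mere closure of W(A) still give
  null vectors. A further obstacle is that boundary points may converge to \<gamma> s while their
  parameters leave every compact part of an open \<open>I\<close>, as for a circle traversed
  infinitely often. Since the curve crosses the ray from an interior point to \<gamma> s
  transversally, the same boundary points also have parameters near \<open>s\<close>.\<close>

no_notation scalar_prod (infix "\<bullet>" 70)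

subsection \<open>Complex Hilbert spaces\<close>

instance complex_hilbert \<subseteq> banach ..

lemma (in complex_hilbert) cinner_scaleC_right: "cinner x (c *\<^sub>C y) = cnj c * cinner x y"
  by (metis cinner_commute cinner_scaleC_left complex_cnj_mult)

lemma scaleC_zero_left [simp]: "0 *\<^sub>C x = (0::'a::complex_hilbert)"
  using scaleR_scaleC[of 0 x] by simp

lemma scaleC_minus_one: "(-1) *\<^sub>C x = - (x::'a::complex_hilbert)"
  using scaleR_scaleC[of "-1" x] by simp

lemma cinner_self: "cinner x x = of_real ((norm x)\<^sup>2)" for x :: "'a::complex_hilbert"
proof -
  have "Re (cinner x x) = (norm x)\<^sup>2"
    by (metis inner_eq_Re_cinner power2_norm_eq_inner)
  moreover have "Im (cinner x x) = 0"
    using cinner_commute[of x x] by (metis cnj.simps(2) equal_neg_zero)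
  ultimately show ?thesis by (simp add: complex_eq_iff)
qed

lemma norm_scaleC: "norm (c *\<^sub>C x) = norm c * norm x" for x :: "'a::complex_hilbert"
proof -
  have "complex_of_real ((norm (c *\<^sub>C x))\<^sup>2) = of_real ((norm c * norm x)\<^sup>2)"
    by (simp only: cinner_self[symmetric] cinner_scaleC_left cinner_scaleC_right)
      (simp add: cinner_self power_mult_distrib complex_norm_square[unfolded of_real_power] mult_ac)
  then show ?thesis by (simp only: of_real_eq_iff) (simp add: power2_eq_iff_nonneg)
qed

text \<open>Rotating \<open>x\<close> by a phase makes the complex inner product real and
  nonnegative, and then the real Cauchy-Schwarz inequality applies.\<close>

lemma norm_cinner_le: "norm (cinner x y) \<le> norm x * norm y" for x :: "'a::complex_hilbert"
proof -
  obtain c where c: "norm c = 1" "c * cinner x y = of_real (norm (cinner x y))"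
  proof (cases "cinner x y = 0")
    case True then show ?thesis using that[of 1] by simp
  next
    case False
    then show ?thesis
      using that[of "cnj (cinner x y) / norm (cinner x y)"]
      by (simp add: norm_divide mult.commute complex_norm_square[symmetric] power2_eq_square)
  qed
  have "norm (cinner x y) = (c *\<^sub>C x) \<bullet> y"
    using c by (simp add: inner_eq_Re_cinner cinner_scaleC_left)
  also have "\<dots> \<le> norm (c *\<^sub>C x) * norm y" by (rule norm_cauchy_schwarz)
  finally show ?thesis using c by (simp add: norm_scaleC)
qed

subsection \<open>Hermitian forms\<close>

text \<open>Linearity in the second argument is left to the symmetry. Boundedness is included
  because the energy arguments and limits below work with continuous forms.\<close>

definition hermitian_form :: "('a::complex_hilbert \<Rightarrow> 'a \<Rightarrow> complex) \<Rightarrow> bool"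
  where "hermitian_form h \<longleftrightarrow>
    (\<forall>x y z. h (x + y) z = h x z + h y z) \<and> (\<forall>c x y. h (c *\<^sub>C x) y = c * h x y) \<and>
    (\<forall>x y. h y x = cnj (h x y)) \<and> (\<exists>K. \<forall>x y. norm (h x y) \<le> K * norm x * norm y)"

lemma hermitian_formI:
  assumes "\<And>x y z. h (x + y) z = h x z + h y z" "\<And>c x y. h (c *\<^sub>C x) y = c * h x y"
    and "\<And>x y. h y x = cnj (h x y)" "\<And>x y. norm (h x y) \<le> K * norm x * norm y"
  shows "hermitian_form h"
  unfolding hermitian_form_def using assms by (intro conjI allI exI[of _ K])

lemma hermitian_formD:
  assumes "hermitian_form h"
  shows hermitian_form_add_left: "h (x + y) z = h x z + h y z"
    and hermitian_form_scaleC_left: "h (c *\<^sub>C x) y = c * h x y"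
    and hermitian_form_commute: "h y x = cnj (h x y)"
    and hermitian_form_add_right: "h z (x + y) = h z x + h z y"
    and hermitian_form_scaleC_right: "h x (c *\<^sub>C y) = cnj c * h x y"
    and hermitian_form_scaleR_left: "h (r *\<^sub>R x) y = of_real r * h x y"
    and hermitian_form_scaleR_right: "h x (r *\<^sub>R y) = of_real r * h x y"
    and hermitian_form_minus_left: "h (- x) y = - h x y"
    and hermitian_form_minus_right: "h x (- y) = - h x y"
    and hermitian_form_diff_left: "h (x - y) z = h x z - h y z"
    and hermitian_form_diff_right: "h z (x - y) = h z x - h z y"
    and hermitian_form_zero_left: "h 0 y = 0"
    and hermitian_form_zero_right: "h x 0 = 0"
proof -
  have add: "h (x + y) z = h x z + h y z" and scale: "h (c *\<^sub>C x) y = c * h x y"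
    and commute: "h y x = cnj (h x y)" for x y z c
    using assms unfolding hermitian_form_def by blast+
  show "h (x + y) z = h x z + h y z" "h (c *\<^sub>C x) y = c * h x y" "h y x = cnj (h x y)"
    by (fact add scale commute)+
  have addr: "h z (x + y) = h z x + h z y" for x y z
    by (metis add commute complex_cnj_add)
  have scaler: "h x (c *\<^sub>C y) = cnj c * h x y" for c x y
    by (metis scale commute complex_cnj_mult)
  show "h z (x + y) = h z x + h z y" "h x (c *\<^sub>C y) = cnj c * h x y"
    by (fact addr scaler)+
  show "h (r *\<^sub>R x) y = of_real r * h x y" "h x (r *\<^sub>R y) = of_real r * h x y"
    by (simp_all add: scaleR_scaleC scale scaler)
  have min: "h (- x) y = - h x y" "h x (- y) = - h x y" for x y
    using scale[of "-1"] scaler[of _ "-1"] by (simp_all add: scaleC_minus_one)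
  show "h (- x) y = - h x y" "h x (- y) = - h x y" by (fact min)+
  show "h (x - y) z = h x z - h y z" "h z (x - y) = h z x - h z y"
    using add[of x "-y"] addr[of _ x "-y"] by (simp_all add: min)
  show "h 0 y = 0" "h x 0 = 0"
    using scale[of 0] scaler[of _ 0] by simp_all
qed

lemmas hermitian_form_simps =
  hermitian_form_add_left hermitian_form_add_right hermitian_form_diff_left
  hermitian_form_diff_right hermitian_form_minus_left hermitian_form_minus_right
  hermitian_form_scaleC_left hermitian_form_scaleC_right hermitian_form_scaleR_left
  hermitian_form_scaleR_right hermitian_form_zero_left hermitian_form_zero_right

lemma hermitian_form_bound:
  assumes "hermitian_form h"
  shows "\<exists>K>0. \<forall>x y. norm (h x y) \<le> K * norm x * norm y"
proof -
  obtain K where K: "\<And>x y. norm (h x y) \<le> K * norm x * norm y"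
    using assms unfolding hermitian_form_def by blast
  have "norm (h x y) \<le> max K 1 * norm x * norm y" for x y
    by (rule order_trans[OF K]) (intro mult_right_mono, auto)
  then show ?thesis by (intro exI[of _ "max K 1"]) simp
qed

lemma hermitian_form_bounded_linear_left:
  assumes "hermitian_form h"
  shows "bounded_linear (\<lambda>x. h x y)"
proof -
  obtain K where "K > 0" and "\<And>x y. norm (h x y) \<le> K * norm x * norm y"
    using hermitian_form_bound[OF assms] by blast
  then show ?thesis
    by (intro bounded_linear_intro[of _ "K * norm y"])
      (auto simp: hermitian_form_simps[OF assms] scaleR_conv_of_real mult_ac)
qed

lemma hermitian_form_bounded_bilinear_Re:
  assumes "hermitian_form h"
  shows "bounded_bilinear (\<lambda>x y. Re (h x y))"
proof -
  obtain K where "K > 0" and K: "\<And>x y. norm (h x y) \<le> K * norm x * norm y"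
    using hermitian_form_bound[OF assms] by blast
  show ?thesis
  proof
    have "norm (Re (h a b)) \<le> norm a * norm b * K" for a b
      using abs_Re_le_cmod[of "h a b"] K[of a b] by (simp add: mult_ac)
    then show "\<exists>K. \<forall>a b. norm (Re (h a b)) \<le> norm a * norm b * K" by blast
  qed (auto simp: hermitian_form_simps[OF assms])
qed

lemma hermitian_form_sum_left:
  assumes "hermitian_form h"
  shows "h (\<Sum>i\<in>J. f i) y = (\<Sum>i\<in>J. h (f i) y)"
  by (rule linear_sum[OF bounded_linear.linear[OF hermitian_form_bounded_linear_left[OF assms]]])

lemma hermitian_form_add_self:
  assumes "hermitian_form h"
  shows "Re (h (x + y) (x + y)) = Re (h x x) + 2 * Re (h x y) + Re (h y y)"
  by (simp add: hermitian_form_simps[OF assms] hermitian_form_commute[OF assms, of y x])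

lemma hermitian_form_cinner: "hermitian_form (cinner :: 'a::complex_hilbert \<Rightarrow> 'a \<Rightarrow> complex)"
  by (rule hermitian_formI[of _ 1])
    (simp_all add: cinner_add_left cinner_scaleC_left norm_cinner_le, rule cinner_commute)

lemma hermitian_form_zero: "hermitian_form (\<lambda>x y. 0)"
  by (rule hermitian_formI[of _ 0]) simp_all

lemma hermitian_form_add:
  assumes f: "hermitian_form f" and g: "hermitian_form g"
  shows "hermitian_form (\<lambda>x y. f x y + g x y)"
proof -
  obtain K where "K > 0" and K: "\<And>x y. norm (f x y) \<le> K * norm x * norm y"
    using hermitian_form_bound[OF f] by blast
  obtain L where "L > 0" and L: "\<And>x y. norm (g x y) \<le> L * norm x * norm y"
    using hermitian_form_bound[OF g] by blast
  show ?thesis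
  proof (rule hermitian_formI[of _ "K + L"])
    show "norm (f x y + g x y) \<le> (K + L) * norm x * norm y" for x y
      using norm_triangle_mono[OF K L, of x y x y] by (simp add: algebra_simps)
    show "f y x + g y x = cnj (f x y + g x y)" for x y
      by (simp add: hermitian_form_commute[OF f, of y x] hermitian_form_commute[OF g, of y x])
  qed (simp_all add: hermitian_form_simps[OF f] hermitian_form_simps[OF g] algebra_simps)
qed

lemma hermitian_form_of_real_mult:
  assumes f: "hermitian_form f"
  shows "hermitian_form (\<lambda>x y. of_real r * f x y)"
proof -
  obtain K where "K > 0" and K: "\<And>x y. norm (f x y) \<le> K * norm x * norm y"
    using hermitian_form_bound[OF f] by blast
  show ?thesis
  proof (rule hermitian_formI[of _ "\<bar>r\<bar> * K"])
    show "norm (of_real r * f x y) \<le> \<bar>r\<bar> * K * norm x * norm y" for x y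
      using mult_left_mono[OF K[of x y], of "\<bar>r\<bar>"] by (simp add: norm_mult mult_ac)
    show "of_real r * f y x = cnj (of_real r * f x y)" for x y
      by (simp add: hermitian_form_commute[OF f, of y x])
  qed (simp_all add: hermitian_form_simps[OF f] algebra_simps)
qed

lemma hermitian_form_sum:
  assumes "\<And>i. i \<in> J \<Longrightarrow> hermitian_form (f i)"
  shows "hermitian_form (\<lambda>x y. \<Sum>i\<in>J. f i x y)"
  using assms
proof (induction J rule: infinite_finite_induct)
  case (insert i J)
  then have "hermitian_form (\<lambda>x y. f i x y + (\<Sum>i\<in>J. f i x y))"
    by (intro hermitian_form_add) auto
  with insert show ?case by simp
qed (simp_all add: hermitian_form_zero)

lemma hermitian_form_rank_one: "hermitian_form (\<lambda>x y. cinner x e * cinner e y)"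
  for e :: "'a::complex_hilbert"
proof (rule hermitian_formI[of _ "(norm e)\<^sup>2"])
  show "norm (cinner x e * cinner e y) \<le> (norm e)\<^sup>2 * norm x * norm y" for x y
    using mult_mono[OF norm_cinner_le norm_cinner_le, of x e e y]
    by (simp add: norm_mult power2_eq_square mult_ac)
  show "cinner y e * cinner e x = cnj (cinner x e * cinner e y)" for x y
    by (simp add: cinner_commute[of y e] cinner_commute[of e x])
qed (simp_all add: cinner_add_left cinner_scaleC_left algebra_simps)

text \<open>On the line through \<open>y\<close> in direction \<open>x\<close> the form is affine
  with slope \<open>2 * Re (h x y)\<close>, so a nonzero slope would let it reach the value 1, which
  is how \<open>s\<close> is chosen. Replacing \<open>y\<close> by \<open>\<i> *\<^sub>C y\<close>
  treats the imaginary part. This turns a zero of the quadratic form into a linear equation.\<close>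

lemma semidefinite_form_null:
  assumes h: "hermitian_form h" and neg: "\<And>x. Re (h x x) \<le> 0" and x: "Re (h x x) = 0"
  shows "h x y = 0"
proof -
  have *: "Re (h x y) = 0" for y
  proof (rule ccontr)
    assume nz: "Re (h x y) \<noteq> 0"
    define s where "s = (1 - Re (h y y)) / (2 * Re (h x y))"
    have "Re (h (s *\<^sub>R x + y) (s *\<^sub>R x + y)) = 2 * s * Re (h x y) + Re (h y y)"
      using x by (simp add: hermitian_form_add_self[OF h] hermitian_form_scaleR_left[OF h]
          hermitian_form_scaleR_right[OF h])
    also have "\<dots> = 1" using nz by (simp add: s_def field_simps)
    finally show False using neg[of "s *\<^sub>R x + y"] by simp
  qed
  have "Im (h x y) = 0"
    using *[of "\<i> *\<^sub>C y"] by (simp add: hermitian_form_scaleC_right[OF h])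
  with * show ?thesis by (simp add: complex_eq_iff)
qed

section \<open>Coercive forms and the operators representing other forms\<close>

text \<open>The common end of two variational arguments: \<open>w\<close> is the defect of an
  extremal sequence, and a parallelogram law supplies \<open>bound\<close>.\<close>

lemma Cauchy_squared_bound:
  fixes X :: "nat \<Rightarrow> 'a::real_normed_vector"
  assumes "c > 0" and bound: "\<And>i j. c * (norm (X i - X j))\<^sup>2 \<le> w i + w j" and w: "w \<longlonglongrightarrow> (0::real)"
  shows "Cauchy X"
proof (rule CauchyI)
  fix e :: real assume e: "e > 0"
  then have "\<forall>\<^sub>F n in sequentially. w n < c * e\<^sup>2 / 2"
    using \<open>c > 0\<close> by (intro order_tendstoD(2)[OF w]) simp
  then obtain N where N: "\<And>n. n \<ge> N \<Longrightarrow> w n < c * e\<^sup>2 / 2"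
    unfolding eventually_sequentially by blast
  have "norm (X i - X j) < e" if "i \<ge> N" "j \<ge> N" for i j
  proof -
    have "w i + w j < c * e\<^sup>2" using N[OF that(1)] N[OF that(2)] by simp
    with bound have "c * (norm (X i - X j))\<^sup>2 < c * e\<^sup>2" by (rule le_less_trans)
    then show ?thesis using e \<open>c > 0\<close> by (simp add: power2_less_imp_less)
  qed
  then show "\<exists>M. \<forall>i\<ge>M. \<forall>j\<ge>M. norm (X i - X j) < e" by blast
qed

text \<open>The solution minimizes the energy \<open>a u u - 2 f u\<close>; a minimizing sequence is Cauchy by the
  parallelogram law.\<close>

lemma symmetric_Lax_Milgram:
  fixes a :: "'a::{real_inner,complete_space} \<Rightarrow> 'a \<Rightarrow> real"
  assumes "bounded_bilinear a" and sym: "\<And>x y. a x y = a y x"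
    and c: "c > 0" and coercive: "\<And>x. c * (norm x)\<^sup>2 \<le> a x x" and "bounded_linear f"
  shows "\<exists>u. \<forall>y. a u y = f y"
proof -
  interpret a: bounded_bilinear a by fact
  interpret f: bounded_linear f by fact
  define J where "J u = a u u - 2 * f u" for u
  define m where "m = Inf (range J)"
  obtain K where K: "\<And>x. norm (f x) \<le> norm x * K" using f.bounded by blast
  \<comment> \<open>Completing the square in \<open>norm u\<close> bounds the energy from
    below.\<close>
  have "J u \<ge> - (K\<^sup>2 / c)" for u
  proof -
    have "0 \<le> (c * norm u - K)\<^sup>2 / c" using c by simp
    also have "\<dots> = c * (norm u)\<^sup>2 - 2 * (norm u * K) + K\<^sup>2 / c"
      using c by (simp add: field_simps power2_eq_square)
    finally show ?thesis using K[of u] coercive[of u] by (simp add: J_def)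
  qed
  then have "bdd_below (range J)" by (intro bdd_belowI) auto
  then have m_le: "m \<le> J u" for u unfolding m_def by (intro cInf_lower) auto
  have "\<exists>u. J u < m + 1 / real (Suc n)" for n
    using cInf_lessD[of "range J" "m + 1 / real (Suc n)"] by (auto simp: m_def)
  then obtain X where X: "\<And>n. J (X n) < m + 1 / real (Suc n)" by metis
  have par: "c * (norm (u - v))\<^sup>2 \<le> 2 * (J u - m) + 2 * (J v - m)" for u v
  proof -
    have "4 * J ((1/2) *\<^sub>R (u + v)) = a (u + v) (u + v) - 4 * f (u + v)"
      by (simp add: J_def a.scaleR_left a.scaleR_right f.scaleR)
    then have "a (u - v) (u - v) = 2 * J u + 2 * J v - 4 * J ((1/2) *\<^sub>R (u + v))"
      by (simp add: J_def a.add_left a.add_right a.diff_left a.diff_right f.add)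
    also have "\<dots> \<le> 2 * J u + 2 * J v - 4 * m" using m_le by simp
    also have "\<dots> = 2 * (J u - m) + 2 * (J v - m)" by simp
    finally show ?thesis using coercive[of "u - v"] by (rule order_trans[rotated])
  qed
  have "Cauchy X"
  proof (rule Cauchy_squared_bound[OF c])
    show "c * (norm (X i - X j))\<^sup>2 \<le> 2 * (1 / real (Suc i)) + 2 * (1 / real (Suc j))" for i j
      using X[of i] X[of j] by (intro order_trans[OF par] add_mono mult_left_mono) auto
    show "(\<lambda>n. 2 * (1 / real (Suc n))) \<longlonglongrightarrow> 0"
      using tendsto_mult_right_zero[OF LIMSEQ_Suc[OF lim_1_over_n[where 'a=real]]] .
  qed
  then obtain u where u: "X \<longlonglongrightarrow> u" using Cauchy_convergent convergent_def by blast
  have "(\<lambda>n. J (X n)) \<longlonglongrightarrow> J u"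
    unfolding J_def by (intro tendsto_intros a.tendsto f.tendsto u)
  moreover have "(\<lambda>n. m + 1 / real (Suc n)) \<longlonglongrightarrow> m + 0"
    by (intro tendsto_intros LIMSEQ_Suc lim_1_over_n)
  ultimately have Ju: "J u \<le> m"
    using LIMSEQ_le[of "\<lambda>n. J (X n)" "J u" "\<lambda>n. m + 1 / real (Suc n)" m] X by (auto intro: less_imp_le)
  have "a u y = f y" for y
  proof (cases "y = 0")
    case False
    define d where "d = a u y - f y"
    have p: "a y y > 0" using coercive[of y] c False
      by (smt (verit) mult_pos_pos zero_less_norm_iff zero_less_power)
    \<comment> \<open>The vertex of the quadratic function \<open>J (u + t *\<^sub>R y)\<close> of
      \<open>t\<close>; its value is below the minimum \<open>m\<close> unless
      \<open>d = 0\<close>.\<close>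
    define t where "t = - d / a y y"
    have "J (u + t *\<^sub>R y) = J u + 2 * t * d + t\<^sup>2 * a y y"
      by (simp add: J_def d_def a.add_left a.add_right a.scaleR_left a.scaleR_right f.add f.scaleR
          sym[of y u] algebra_simps power2_eq_square)
    also have "\<dots> = J u - d\<^sup>2 / a y y"
      using p by (simp add: t_def field_simps power2_eq_square)
    finally have "d\<^sup>2 / a y y \<le> 0" using m_le[of "u + t *\<^sub>R y"] Ju by linarith
    then have "d = 0" using p by (simp add: divide_le_0_iff)
    then show ?thesis by (simp add: d_def)
  qed (simp add: a.zero_right f.zero)
  then show ?thesis by blast
qed

text \<open>Lax-Milgram matches the real parts, and testing with \<open>\<i> *\<^sub>C y\<close>
  matches the imaginary parts. Coercivity makes the solution unique, hence complex linear in
  \<open>x\<close>, and bounds it by \<open>K / c\<close>. In effect \<open>a\<close> serves as an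
  equivalent inner product in which \<open>T\<close> is the operator of \<open>h\<close>.\<close>

lemma form_representing_operator:
  assumes a: "hermitian_form a" and c: "c > 0" and coercive: "\<And>x. c * (norm x)\<^sup>2 \<le> Re (a x x)"
    and h: "hermitian_form h"
  shows "\<exists>T. bounded_clinear T \<and> (\<forall>x y. a (T x) y = h x y)"
proof -
  obtain K where "K > 0" and K: "\<And>x y. norm (h x y) \<le> K * norm x * norm y"
    using hermitian_form_bound[OF h] by blast
  have "\<exists>u. \<forall>y. a u y = h x y" for x
  proof -
    have "\<exists>u. \<forall>y. Re (a u y) = Re (h x y)"
    proof (rule symmetric_Lax_Milgram[OF hermitian_form_bounded_bilinear_Re[OF a] _ c coercive])
      show "Re (a x y) = Re (a y x)" for x y by (subst hermitian_form_commute[OF a]) simp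
      show "bounded_linear (\<lambda>y. Re (h x y))"
        by (rule bounded_bilinear.bounded_linear_right[OF hermitian_form_bounded_bilinear_Re[OF h]])
    qed
    then obtain u where u: "\<And>y. Re (a u y) = Re (h x y)" by blast
    have "Im (a u y) = Im (h x y)" for y
      using u[of "\<i> *\<^sub>C y"]
      by (simp add: hermitian_form_scaleC_right[OF a] hermitian_form_scaleC_right[OF h])
    with u show ?thesis by (auto simp: complex_eq_iff)
  qed
  then obtain T where T: "\<And>x y. a (T x) y = h x y" by metis
  have eq: "u = v" if "\<And>y. a u y = a v y" for u v
  proof -
    have "a (u - v) (u - v) = 0" using that by (simp add: hermitian_form_simps[OF a])
    then have "c * (norm (u - v))\<^sup>2 \<le> 0" using coercive[of "u - v"] by simp
    then show ?thesis using c by (simp add: mult_le_0_iff)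
  qed
  have "norm (T x) \<le> norm x * (K / c)" for x
  proof (cases "T x = 0")
    case True
    then show ?thesis using \<open>K > 0\<close> c by simp
  next
    case False
    have "c * (norm (T x))\<^sup>2 \<le> norm (h x (T x))"
      using coercive[of "T x"] complex_Re_le_cmod[of "h x (T x)"] by (simp add: T)
    also have "\<dots> \<le> K * norm x * norm (T x)" by (rule K)
    finally have "c * norm (T x) \<le> K * norm x" using False by (simp add: power2_eq_square)
    then show ?thesis using c by (simp add: field_simps)
  qed
  moreover have "T (x + y) = T x + T y" for x y
    by (rule eq) (simp add: T hermitian_form_add_left[OF a] hermitian_form_add_left[OF h])
  moreover have sc: "T (s *\<^sub>C x) = s *\<^sub>C T x" for s x
    by (rule eq) (simp add: T hermitian_form_scaleC_left[OF a] hermitian_form_scaleC_left[OF h])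
  moreover have "T (r *\<^sub>R x) = r *\<^sub>R T x" for r x by (simp add: scaleR_scaleC sc)
  ultimately have "bounded_clinear T"
    unfolding bounded_clinear_def by (blast intro: bounded_linear_intro)
  with T show ?thesis by blast
qed

lemma hermitian_form_sum_right:
  assumes "hermitian_form h"
  shows "h y (\<Sum>i\<in>J. f i) = (\<Sum>i\<in>J. h y (f i))"
proof -
  have "h y (\<Sum>i\<in>J. f i) = cnj (h (\<Sum>i\<in>J. f i) y)" by (rule hermitian_form_commute[OF assms])
  also have "\<dots> = (\<Sum>i\<in>J. h y (f i))"
    by (simp add: hermitian_form_sum_left[OF assms] hermitian_form_commute[OF assms, of y])
  finally show ?thesis .
qed

lemmas cinner_simps = hermitian_form_simps[OF hermitian_form_cinner]
  hermitian_form_sum_left[OF hermitian_form_cinner] hermitian_form_sum_right[OF hermitian_form_cinner]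

subsection \<open>Orthonormal families\<close>

text \<open>Only the first \<open>m\<close> terms are constrained, so that the same notion serves
  finite families and, for all \<open>m\<close> at once, orthonormal sequences.\<close>

definition orthonormal_upto :: "nat \<Rightarrow> (nat \<Rightarrow> 'a::complex_hilbert) \<Rightarrow> bool"
  where "orthonormal_upto m e \<longleftrightarrow> (\<forall>i<m. \<forall>j<m. cinner (e i) (e j) = (if i = j then 1 else 0))"

lemma orthonormal_upto_decomposition:
  assumes e: "orthonormal_upto m e"
  defines "p \<equiv> \<lambda>x. \<Sum>i<m. cinner x (e i) *\<^sub>C e i"
  shows "j < m \<Longrightarrow> cinner (x - p x) (e j) = 0"
    and "(norm (p x))\<^sup>2 = (\<Sum>i<m. (norm (cinner x (e i)))\<^sup>2)"
    and "(norm x)\<^sup>2 = (norm (x - p x))\<^sup>2 + (norm (p x))\<^sup>2"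
proof -
  have p: "cinner (p x) (e j) = cinner x (e j)" if "j < m" for j
  proof -
    have "cinner (p x) (e j) = (\<Sum>i<m. cinner x (e i) * cinner (e i) (e j))"
      by (simp add: p_def cinner_simps)
    also have "\<dots> = (\<Sum>i<m. if i = j then cinner x (e i) else 0)"
      using e that by (intro sum.cong) (auto simp: orthonormal_upto_def)
    finally have "cinner (p x) (e j) = (\<Sum>i<m. if i = j then cinner x (e i) else 0)" .
    then show ?thesis using that by simp
  qed
  have ortho: "cinner (x - p x) (e j) = 0" if "j < m" for j
    using p[OF that] by (simp add: cinner_simps)
  have "cinner (x - p x) (p x) = 0"
    by (subst (2) p_def)
      (simp add: hermitian_form_sum_right[OF hermitian_form_cinner] cinner_scaleC_right ortho)
  then have 1: "(norm x)\<^sup>2 = (norm (x - p x))\<^sup>2 + (norm (p x))\<^sup>2"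
    using hermitian_form_add_self[OF hermitian_form_cinner, of "x - p x" "p x"]
    by (simp add: cinner_self del: of_real_power)
  have "cinner (p x) (p x) = (\<Sum>i<m. cnj (cinner x (e i)) * cinner x (e i))"
    by (subst (2) p_def) (simp add: cinner_simps p)
  also have "\<dots> = of_real (\<Sum>i<m. (norm (cinner x (e i)))\<^sup>2)"
    by (simp add: complex_norm_square mult.commute del: of_real_power)
  finally have 2: "(norm (p x))\<^sup>2 = (\<Sum>i<m. (norm (cinner x (e i)))\<^sup>2)"
    by (simp only: cinner_self of_real_eq_iff)
  show "j < m \<Longrightarrow> cinner (x - p x) (e j) = 0" by (rule ortho)
  show "(norm (p x))\<^sup>2 = (\<Sum>i<m. (norm (cinner x (e i)))\<^sup>2)"
    "(norm x)\<^sup>2 = (norm (x - p x))\<^sup>2 + (norm (p x))\<^sup>2" by (fact 2 1)+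
qed

section \<open>Weakly null sequences and the essential numerical range\<close>

lemma orthonormal_weakly_null:
  assumes e: "\<And>m. orthonormal_upto m e"
  shows "(\<lambda>k. cinner y (e k)) \<longlonglongrightarrow> 0"
proof -
  have "(\<Sum>i<m. (norm (cinner y (e i)))\<^sup>2) \<le> (norm y)\<^sup>2" for m
    using orthonormal_upto_decomposition(2,3)[OF e, of y m] by simp
  then have "summable (\<lambda>i. (norm (cinner y (e i)))\<^sup>2)"
    by (intro summableI_nonneg_bounded) auto
  then have "(\<lambda>i. sqrt ((norm (cinner y (e i)))\<^sup>2)) \<longlonglongrightarrow> sqrt 0"
    by (intro tendsto_real_sqrt summable_LIMSEQ_zero)
  then show ?thesis by (simp add: tendsto_norm_zero_iff)
qed

text \<open>A compact perturbation is invisible along an orthonormal sequence: on a subsequence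
  \<open>K (f j)\<close> converges in norm to some \<open>y\<close>, while
  \<open>cinner y (f j)\<close> tends to 0 by Bessel's inequality.\<close>

lemma essential_numerical_range_orthonormal_limit:
  assumes A: "bounded_clinear A" and e: "\<And>m. orthonormal_upto m e" and r: "strict_mono r"
    and z: "(\<lambda>j. cinner (A (e (r j))) (e (r j))) \<longlonglongrightarrow> z"
  shows "z \<in> essential_numerical_range A"
  unfolding essential_numerical_range_def
proof (rule INT_I, simp only: mem_Collect_eq)
  fix K :: "'a \<Rightarrow> 'a" assume K: "compact_operator K"
  have norm_e: "norm (e k) = 1" for k
    using e[of "Suc k"] cinner_self[of "e k"] by (simp add: orthonormal_upto_def power2_eq_1_iff del: of_real_power)
      (smt (verit) norm_ge_zero)
  have "K (e (r j)) \<in> closure (K ` cball 0 1)" for j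
    by (rule subsetD[OF closure_subset]) (simp add: norm_e)
  moreover have "compact (closure (K ` cball 0 1))" using K by (simp add: compact_operator_def)
  ultimately obtain y s where s: "strict_mono s" and y: "((\<lambda>j. K (e (r j))) \<circ> s) \<longlonglongrightarrow> y"
    unfolding compact_def by (metis (no_types, lifting))
  define f where "f j = e (r (s j))" for j
  have rs: "strict_mono (r \<circ> s)" using r s by (rule strict_mono_o)
  have "(\<lambda>j. cinner y (f j)) \<longlonglongrightarrow> 0"
    using LIMSEQ_subseq_LIMSEQ[OF orthonormal_weakly_null[OF e] rs] by (simp add: f_def o_def)
  moreover have "(\<lambda>j. cinner (K (f j) - y) (f j)) \<longlonglongrightarrow> 0"
  proof (rule Lim_null_comparison)
    show "\<forall>\<^sub>F j in sequentially. norm (cinner (K (f j) - y) (f j)) \<le> norm (K (f j) - y)"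
      using norm_cinner_le[of "K (f _) - y" "f _"] by (simp add: f_def norm_e)
    show "(\<lambda>j. norm (K (f j) - y)) \<longlonglongrightarrow> 0"
      using y by (intro tendsto_norm_zero LIM_zero) (simp add: f_def o_def)
  qed
  moreover have "(\<lambda>j. cinner (A (f j)) (f j)) \<longlonglongrightarrow> z"
    using LIMSEQ_subseq_LIMSEQ[OF z s] by (simp add: f_def o_def)
  ultimately have "(\<lambda>j. cinner (A (f j)) (f j) + (cinner y (f j) + cinner (K (f j) - y) (f j)))
      \<longlonglongrightarrow> z + (0 + 0)"
    by (intro tendsto_add)
  then have "(\<lambda>j. cinner (A (f j) + K (f j)) (f j)) \<longlonglongrightarrow> z"
    by (simp add: cinner_simps)
  moreover have "cinner (A (f j) + K (f j)) (f j) \<in> numerical_range (\<lambda>x. A x + K x)" for j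
    unfolding numerical_range_def by (intro image_eqI[of _ _ "f j"]) (simp_all add: f_def norm_e)
  ultimately show "z \<in> closure (numerical_range (\<lambda>x. A x + K x))"
    unfolding closure_sequential
    by (intro exI[of _ "\<lambda>j. cinner (A (f j) + K (f j)) (f j)"]) simp
qed

lemma bounded_clinear_simps:
  assumes "bounded_clinear A"
  shows "A (x + y) = A x + A y" "A (x - y) = A x - A y" "A 0 = 0" "A (c *\<^sub>C x) = c *\<^sub>C A x"
    "A (r *\<^sub>R x) = r *\<^sub>R A x"
  using assms by (auto simp: bounded_clinear_def linear_add linear_diff linear_0 linear_scale
      dest!: bounded_linear.linear)

text \<open>If no finite family works, then none works with \<delta> = 1 / (k + 1), and this yields
  recursively a unit vector \<open>e k\<close> orthogonal to all earlier ones with \<phi> (e k) > -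
  1 / (k + 1). A limit of the values along this orthonormal sequence lies in the essential numerical
  range, but not in the open half plane.\<close>

lemma essential_numerical_range_half_plane:
  fixes n p :: complex
  assumes A: "bounded_clinear A" and neg: "\<And>z. z \<in> essential_numerical_range A \<Longrightarrow> n \<bullet> (z - p) < 0"
  shows "\<exists>m e. \<exists>\<delta>>0. orthonormal_upto m e \<and> (\<forall>x. (\<forall>i<m. cinner x (e i) = 0) \<longrightarrow>
      n \<bullet> (cinner (A x) x - of_real ((norm x)\<^sup>2) * p) \<le> - \<delta> * (norm x)\<^sup>2)" (is ?goal)
proof (rule ccontr)
  assume none: "\<not> ?goal"
  define \<phi> where "\<phi> x = n \<bullet> (cinner (A x) x - of_real ((norm x)\<^sup>2) * p)" for x
  define P where "P e k x \<longleftrightarrow> norm x = 1 \<and> (\<forall>i<k. cinner x (e i) = 0) \<and> \<phi> x > - 1 / real (Suc k)"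
    for e :: "nat \<Rightarrow> 'a" and k x
  have ortho: "orthonormal_upto m e" if "\<And>k. k < m \<Longrightarrow> P e k (e k)" for m e
    unfolding orthonormal_upto_def
  proof (intro allI impI)
    fix i j assume ij: "i < m" "j < m"
    consider "i = j" | "i < j" | "j < i" by linarith
    then show "cinner (e i) (e j) = (if i = j then 1 else 0)"
    proof cases
      case 1 then show ?thesis using that[OF ij(1)] by (simp add: P_def cinner_self)
    next
      case 2 then show ?thesis using that[OF ij(2)] cinner_commute[of "e i" "e j"] by (simp add: P_def)
    next
      case 3 then show ?thesis using that[OF ij(1)] by (simp add: P_def)
    qed
  qed
  have "\<exists>e. \<forall>k. P e k (e k)"
  proof (rule dependent_wellorder_choice)
    show "P f k x = P g k x" if "\<And>i. i < k \<Longrightarrow> f i = g i" for f g k x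
      using that by (simp add: P_def)
    fix k e assume "\<And>i. i < k \<Longrightarrow> P e i (e i)"
    then have e: "orthonormal_upto k e" by (rule ortho)
    have "\<not> (\<forall>x. (\<forall>i<k. cinner x (e i) = 0) \<longrightarrow> \<phi> x \<le> - (1 / real (Suc k)) * (norm x)\<^sup>2)"
    proof
      assume *: "\<forall>x. (\<forall>i<k. cinner x (e i) = 0) \<longrightarrow> \<phi> x \<le> - (1 / real (Suc k)) * (norm x)\<^sup>2"
      have ?goal
        by (intro exI[of _ k] exI[of _ e] exI[of _ "1 / real (Suc k)"] conjI e
            *[unfolded \<phi>_def]) simp
      with none show False by contradiction
    qed
    then obtain x where x: "\<forall>i<k. cinner x (e i) = 0"
      and "\<not> \<phi> x \<le> - (1 / real (Suc k)) * (norm x)\<^sup>2"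
      by blast
    then have \<phi>: "\<phi> x > - (1 / real (Suc k)) * (norm x)\<^sup>2" by simp
    have "\<phi> 0 = 0" by (simp add: \<phi>_def cinner_simps)
    with \<phi> have nz: "norm x > 0" by auto
    define y where "y = (1 / norm x) *\<^sub>R x"
    have "norm y = 1" using nz by (simp add: y_def)
    moreover have "\<phi> y = \<phi> x / (norm x)\<^sup>2"
    proof -
      have "cinner (A y) y - of_real ((norm y)\<^sup>2) * p
          = (1 / (norm x)\<^sup>2) *\<^sub>R (cinner (A x) x - of_real ((norm x)\<^sup>2) * p)"
        using nz unfolding y_def
        by (simp add: bounded_clinear_simps[OF A] cinner_simps scaleR_conv_of_real field_simps power2_eq_square)
      then show ?thesis unfolding \<phi>_def by simp
    qed
    then have "\<phi> y > - 1 / real (Suc k)"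
      using \<phi> nz by (simp add: pos_less_divide_eq del: of_nat_Suc)
    moreover have "cinner y (e i) = 0" if "i < k" for i
      using x that by (simp add: y_def cinner_simps)
    ultimately show "\<exists>x. P e k x" unfolding P_def by blast
  qed
  then obtain e where P: "\<And>k. P e k (e k)" by blast
  have e: "orthonormal_upto m e" for m using ortho[of m e] P by blast
  have norm_e: "norm (e k) = 1" for k using P by (simp add: P_def)
  obtain B where B: "\<And>x. norm (A x) \<le> norm x * B"
    using A bounded_linear.bounded[of A] by (auto simp: bounded_clinear_def)
  have "norm (cinner (A (e k)) (e k)) \<le> B" for k
    using norm_cinner_le[of "A (e k)" "e k"] B[of "e k"] by (simp add: norm_e)
  then have "bounded (range (\<lambda>k. cinner (A (e k)) (e k)))"
    unfolding bounded_iff by blast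
  then obtain z r where r: "strict_mono r" and z: "((\<lambda>k. cinner (A (e k)) (e k)) \<circ> r) \<longlonglongrightarrow> z"
    using bounded_imp_convergent_subsequence by blast
  have "n \<bullet> (z - p) < 0"
    by (intro neg essential_numerical_range_orthonormal_limit[OF A e r]) (use z in \<open>simp add: o_def\<close>)
  moreover have "0 \<le> n \<bullet> (z - p)"
  proof (rule LIMSEQ_le)
    show "(\<lambda>j. - 1 / real (Suc (r j))) \<longlonglongrightarrow> 0"
      using tendsto_minus[OF LIMSEQ_subseq_LIMSEQ[OF LIMSEQ_Suc[OF lim_1_over_n[where 'a=real]] r]]
      by (simp add: o_def del: of_nat_Suc)
    show "(\<lambda>j. \<phi> (e (r j))) \<longlonglongrightarrow> n \<bullet> (z - p)"
      unfolding \<phi>_def using z by (intro tendsto_intros) (auto simp: o_def norm_e intro: tendsto_diff)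
    show "\<exists>N. \<forall>j\<ge>N. - 1 / real (Suc (r j)) \<le> \<phi> (e (r j))"
      using P unfolding P_def by (auto intro: less_imp_le)
  qed
  ultimately show False by simp
qed

section \<open>Forms that are negative definite modulo finite rank\<close>

text \<open>Split \<open>x\<close> into its projection \<open>p\<close> onto the span of the
  \<open>e i\<close> and the rest \<open>q\<close>. On \<open>q\<close> the form is definite, half
  of this absorbs the cross term, and the penalty on \<open>p\<close> pays for what remains.\<close>

lemma form_coercive_modulo_finite_rank:
  assumes b: "hermitian_form b" and neg: "\<And>x. Re (b x x) \<le> 0"
    and e: "orthonormal_upto m e" and \<delta>: "\<delta> > 0"
    and ess: "\<And>x. (\<And>i. i < m \<Longrightarrow> cinner x (e i) = 0) \<Longrightarrow> Re (b x x) \<le> - \<delta> * (norm x)\<^sup>2"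
  shows "\<exists>M>0. \<exists>c>0. \<forall>x. c * (norm x)\<^sup>2 \<le> M * (\<Sum>i<m. (norm (cinner x (e i)))\<^sup>2) - Re (b x x)"
proof -
  obtain K where K: "K > 0" "\<And>x y. norm (b x y) \<le> K * norm x * norm y"
    using hermitian_form_bound[OF b] by blast
  \<comment> \<open>The first summand comes from absorbing the cross term; the second restores
    coercivity with constant \<delta> / 2 on the span of the \<open>e i\<close>.\<close>
  define M where "M = 2 * K\<^sup>2 / \<delta> + \<delta> / 2"
  have "\<delta> / 2 * (norm x)\<^sup>2 \<le> M * (\<Sum>i<m. (norm (cinner x (e i)))\<^sup>2) - Re (b x x)" for x
  proof -
    define p where "p = (\<Sum>i<m. cinner x (e i) *\<^sub>C e i)"
    note ortho = orthonormal_upto_decomposition(1)[OF e, of _ x, folded p_def]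
    note p = orthonormal_upto_decomposition(2)[OF e, of x, folded p_def]
    note x = orthonormal_upto_decomposition(3)[OF e, of x, folded p_def]
    define q where "q = x - p"
    have "Re (b x x) = Re (b p p) + 2 * Re (b p q) + Re (b q q)"
      using hermitian_form_add_self[OF b, of p q] by (simp add: q_def)
    moreover have "Re (b p q) \<le> K * norm p * norm q"
      using complex_Re_le_cmod K(2) by (rule order_trans)
    moreover have "Re (b q q) \<le> - \<delta> * (norm q)\<^sup>2" using ess ortho by (simp add: q_def)
    moreover have "2 * (K * norm p * norm q) \<le> 2 * K\<^sup>2 / \<delta> * (norm p)\<^sup>2 + \<delta> / 2 * (norm q)\<^sup>2"
    proof -
      have "0 \<le> (2 * K * norm p - \<delta> * norm q)\<^sup>2 / (2 * \<delta>)" using \<delta> by simp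
      also have "\<dots> = 2 * K\<^sup>2 / \<delta> * (norm p)\<^sup>2 + \<delta> / 2 * (norm q)\<^sup>2 - 2 * (K * norm p * norm q)"
        using \<delta> by (simp add: field_simps power2_eq_square)
      finally show ?thesis by simp
    qed
    ultimately have "Re (b x x) \<le> 2 * K\<^sup>2 / \<delta> * (norm p)\<^sup>2 - \<delta> / 2 * (norm q)\<^sup>2"
      using neg[of p] by simp
    then show ?thesis unfolding p[symmetric] x q_def[symmetric] M_def by (simp add: algebra_simps)
  qed
  moreover have "M > 0" using K \<delta> by (simp add: M_def add_nonneg_pos)
  ultimately show ?thesis using \<delta> half_gt_zero by blast
qed

lemma simultaneous_convergent_subsequence:
  fixes f :: "nat \<Rightarrow> nat \<Rightarrow> 'a::heine_borel"
  assumes "\<And>i. i < m \<Longrightarrow> bounded (range (f i))"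
  shows "\<exists>r. strict_mono r \<and> (\<forall>i<m. convergent (f i \<circ> r))"
  using assms
proof (induction m)
  case 0
  then show ?case by (auto intro: strict_mono_id)
next
  case (Suc m)
  then have "\<exists>r. strict_mono r \<and> (\<forall>i<m. convergent (f i \<circ> r))"
    by (simp add: o_def)
  then obtain r where r: "strict_mono r" "\<And>i. i < m \<Longrightarrow> convergent (f i \<circ> r)" by blast
  have "bounded (range (f m \<circ> r))"
    using Suc.prems[of m] by (rule bounded_subset) auto
  then obtain l s where s: "strict_mono s" "((f m \<circ> r) \<circ> s) \<longlonglongrightarrow> l"
    using bounded_imp_convergent_subsequence by blast
  have "convergent (f i \<circ> (r \<circ> s))" if "i < Suc m" for i
  proof (cases "i = m")
    case True then show ?thesis using s(2) by (auto simp: convergent_def o_assoc)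
  next
    case False
    then show ?thesis
      using convergent_subseq_convergent[OF r(2) s(1), of i] that by (simp add: o_assoc)
  qed
  then show ?case using strict_mono_o[OF r(1) s(1)] by blast
qed

text \<open>A maximizing sequence of \<open>b\<close> on the sphere need not converge, but its
  finitely many coefficients against the \<open>e i\<close> do so along a subsequence. The coercive
  estimate, applied to differences, then makes that subsequence Cauchy in norm.\<close>

lemma coercive_maximum_attained:
  fixes b :: "'a::complex_hilbert \<Rightarrow> 'a \<Rightarrow> complex" and e :: "nat \<Rightarrow> 'a"
  assumes b: "hermitian_form b" and neg: "\<And>x. Re (b x x) \<le> 0" and c: "c > 0" and M: "M > 0"
    and coercive: "\<And>x. c * (norm x)\<^sup>2 \<le> M * (\<Sum>i<m. (norm (cinner x (e i)))\<^sup>2) - Re (b x x)"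
    and X: "\<And>n. norm (X n) = 1" and lim: "(\<lambda>n. Re (b (X n) (X n))) \<longlonglongrightarrow> 0"
  shows "\<exists>x. norm x = 1 \<and> Re (b x x) = 0"
proof -
  have "norm (cinner (X n) (e i)) \<le> norm (e i)" for n i
    using norm_cinner_le[of "X n" "e i"] by (simp add: X)
  then have "bounded (range (\<lambda>n. cinner (X n) (e i)))" for i
    unfolding bounded_iff by blast
  then obtain r where r: "strict_mono r"
    and conv: "\<And>i. i < m \<Longrightarrow> convergent ((\<lambda>n. cinner (X n) (e i)) \<circ> r)"
    using simultaneous_convergent_subsequence[of m "\<lambda>i n. cinner (X n) (e i)"] by blast
  then obtain \<eta> where \<eta>: "\<And>i. i < m \<Longrightarrow> ((\<lambda>n. cinner (X n) (e i)) \<circ> r) \<longlonglongrightarrow> \<eta> i"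
    unfolding convergent_def by metis
  define Y where "Y n = X (r n)" for n
  have b_Y: "(\<lambda>n. Re (b (Y n) (Y n))) \<longlonglongrightarrow> 0"
    using LIMSEQ_subseq_LIMSEQ[OF lim r] by (simp add: Y_def o_def)
  \<comment> \<open>Comparing with the limits \<eta> i instead of with each other splits the defect
    of a pair into one term per index.\<close>
  define w where "w n = 2 * M * (\<Sum>i<m. (norm (cinner (Y n) (e i) - \<eta> i))\<^sup>2) - 2 * Re (b (Y n) (Y n))" for n
  have "w \<longlonglongrightarrow> 2 * M * (\<Sum>i<m. (norm (\<eta> i - \<eta> i))\<^sup>2) - 2 * 0"
    unfolding w_def using \<eta> b_Y
    by (intro tendsto_intros) (auto simp: Y_def o_def)
  moreover have "c * (norm (Y i - Y j))\<^sup>2 \<le> w i + w j" for i j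
  proof -
    have "(norm (cinner (Y i - Y j) (e k)))\<^sup>2
        \<le> 2 * (norm (cinner (Y i) (e k) - \<eta> k))\<^sup>2 + 2 * (norm (cinner (Y j) (e k) - \<eta> k))\<^sup>2" for k
    proof -
      define u v where "u = cinner (Y i) (e k) - \<eta> k" and "v = cinner (Y j) (e k) - \<eta> k"
      have "(norm (u - v))\<^sup>2 \<le> 2 * (norm u)\<^sup>2 + 2 * (norm v)\<^sup>2"
      proof -
        have "(norm (u - v))\<^sup>2 + (norm (u + v))\<^sup>2 = 2 * (norm u)\<^sup>2 + 2 * (norm v)\<^sup>2"
          by (simp add: power2_norm_eq_inner inner_simps inner_commute)
        then show ?thesis by (smt (verit) zero_le_power2)
      qed
      then show ?thesis by (simp add: u_def v_def cinner_simps)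
    qed
    then have "M * (\<Sum>k<m. (norm (cinner (Y i - Y j) (e k)))\<^sup>2)
        \<le> M * (\<Sum>k<m. 2 * (norm (cinner (Y i) (e k) - \<eta> k))\<^sup>2 + 2 * (norm (cinner (Y j) (e k) - \<eta> k))\<^sup>2)"
      using M by (intro mult_left_mono sum_mono) auto
    \<comment> \<open>Parallelogram law for \<open>b\<close>, in which the value at
      \<open>Y i + Y j\<close> is dropped because it is nonpositive.\<close>
    moreover have "- Re (b (Y i - Y j) (Y i - Y j)) \<le> - 2 * Re (b (Y i) (Y i)) - 2 * Re (b (Y j) (Y j))"
      using neg[of "Y i + Y j"] by (simp add: hermitian_form_simps[OF b])
    ultimately show ?thesis
      using coercive[of "Y i - Y j"] unfolding w_def
      by (simp add: sum.distrib distrib_left flip: sum_distrib_left)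
  qed
  ultimately have "Cauchy Y" using c by (intro Cauchy_squared_bound[of c Y w]) auto
  then obtain x where x: "Y \<longlonglongrightarrow> x" using Cauchy_convergent convergent_def by blast
  have "(\<lambda>n. Re (b (Y n) (Y n))) \<longlonglongrightarrow> Re (b x x)"
    by (rule bounded_bilinear.tendsto[OF hermitian_form_bounded_bilinear_Re[OF b] x x])
  with b_Y have "Re (b x x) = 0" using LIMSEQ_unique by blast
  moreover have "norm x = 1"
    using tendsto_norm[OF x] by (simp add: Y_def X LIMSEQ_const_iff)
  ultimately show ?thesis by blast
qed

subsection \<open>Kernels of analytic families of forms\<close>

text \<open>The function \<open>d\<close> is the determinant, which the Leibniz formula shows to be
  a polynomial in the entries. Matrices are confined to this lemma; its users see only families of
  scalars.\<close>

lemma holomorphic_singular_locus: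
  fixes N :: "nat \<Rightarrow> nat \<Rightarrow> complex \<Rightarrow> complex"
  assumes hol: "\<And>i j. i < m \<Longrightarrow> j < m \<Longrightarrow> N i j holomorphic_on S"
  shows "\<exists>d. d holomorphic_on S \<and>
    (\<forall>z. d z = 0 \<longleftrightarrow> (\<exists>\<xi>. (\<exists>j<m. \<xi> j \<noteq> 0) \<and> (\<forall>i<m. (\<Sum>j<m. N i j z * \<xi> j) = 0)))"
proof (intro exI conjI allI)
  define A where "A z = Matrix.mat m m (\<lambda>(i, j). N i j z)" for z
  define d where "d z = Determinant.det (A z)" for z
  have A: "A z \<in> carrier_mat m m" for z by (simp add: A_def)
  have entry: "(\<Prod>i = 0..<m. A z $$ (i, p i)) = (\<Prod>i = 0..<m. N i (p i) z)" if "p permutes {0..<m}" for p z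
  proof (intro prod.cong refl)
    fix i assume i: "i \<in> {0..<m}"
    then have "p i \<in> {0..<m}" using permutes_in_image[OF that] by blast
    with i show "A z $$ (i, p i) = N i (p i) z" by (simp add: A_def)
  qed
  have "d z = (\<Sum>p | p permutes {0..<m}. signof p * (\<Prod>i = 0..<m. N i (p i) z))" for z
    unfolding d_def det_def using A[of z] entry by (auto intro!: sum.cong)
  moreover have "(\<lambda>z. \<Sum>p | p permutes {0..<m}. signof p * (\<Prod>i = 0..<m. N i (p i) z)) holomorphic_on S"
  proof (intro holomorphic_on_sum holomorphic_on_mult holomorphic_on_const holomorphic_on_prod)
    fix p i assume "p \<in> {p. p permutes {0..<m}}" and i: "i \<in> {0..<m}"
    then have "p i \<in> {0..<m}" using permutes_in_image[of p "{0..<m}" i] by simp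
    with i show "N i (p i) holomorphic_on S" by (intro hol) auto
  qed
  ultimately show "d holomorphic_on S" by (simp cong: holomorphic_cong)
  have mult: "vec_index (A z *\<^sub>v v) i = (\<Sum>j<m. N i j z * vec_index v j)" if "v \<in> carrier_vec m" "i < m" for z v i
    using that by (auto simp: A_def scalar_prod_def atLeast0LessThan intro!: sum.cong)
  show "d z = 0 \<longleftrightarrow> (\<exists>\<xi>. (\<exists>j<m. \<xi> j \<noteq> 0) \<and> (\<forall>i<m. (\<Sum>j<m. N i j z * \<xi> j) = 0))" (is "_ = ?R") for z
  proof -
    have "d z = 0 \<longleftrightarrow> (\<exists>v. v \<in> carrier_vec m \<and> v \<noteq> 0\<^sub>v m \<and> A z *\<^sub>v v = 0\<^sub>v m)"
      unfolding d_def by (rule det_0_iff_vec_prod_zero_field[OF A])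
    also have "\<dots> \<longleftrightarrow> ?R"
    proof (intro iffI)
      assume "\<exists>v. v \<in> carrier_vec m \<and> v \<noteq> 0\<^sub>v m \<and> A z *\<^sub>v v = 0\<^sub>v m"
      then obtain v where v: "v \<in> carrier_vec m" "v \<noteq> 0\<^sub>v m" "A z *\<^sub>v v = 0\<^sub>v m" by blast
      have "\<exists>j<m. vec_index v j \<noteq> 0"
      proof (rule ccontr)
        assume "\<not> (\<exists>j<m. vec_index v j \<noteq> 0)"
        then have "v = 0\<^sub>v m" using v(1) by (intro eq_vecI) auto
        with v(2) show False by contradiction
      qed
      moreover have "(\<Sum>j<m. N i j z * vec_index v j) = 0" if "i < m" for i
        using mult[OF v(1) that, of z] v(3) that by simp
      ultimately show ?R by (intro exI[of _ "\<lambda>j. vec_index v j"]) blast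
    next
      assume ?R
      then obtain \<xi> j where \<xi>: "j < m" "\<xi> j \<noteq> 0" "\<And>i. i < m \<Longrightarrow> (\<Sum>j<m. N i j z * \<xi> j) = 0" by blast
      define v where "v = Matrix.vec m \<xi>"
      have v: "v \<in> carrier_vec m" by (simp add: v_def)
      have "vec_index v j \<noteq> vec_index (0\<^sub>v m) j" using \<xi> by (simp add: v_def)
      then have "v \<noteq> 0\<^sub>v m" by auto
      moreover have "A z *\<^sub>v v = 0\<^sub>v m"
      proof (rule eq_vecI)
        show "dim_vec (A z *\<^sub>v v) = dim_vec (0\<^sub>v m)" by (simp add: A_def)
        fix i assume "i < dim_vec (0\<^sub>v m :: complex Matrix.vec)"
        then have i: "i < m" by simp
        have "vec_index (A z *\<^sub>v v) i = (\<Sum>j<m. N i j z * \<xi> j)"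
          unfolding mult[OF v i] by (simp add: v_def)
        then show "vec_index (A z *\<^sub>v v) i = vec_index (0\<^sub>v m) i" using \<xi>(3)[OF i] i by simp
      qed
      ultimately show "\<exists>v. v \<in> carrier_vec m \<and> v \<noteq> 0\<^sub>v m \<and> A z *\<^sub>v v = 0\<^sub>v m" using v by blast
    qed
    finally show ?thesis .
  qed
qed

section \<open>Holomorphic series and inversion by the Neumann series\<close>

lemma holomorphic_on_suminf:
  fixes f :: "nat \<Rightarrow> complex \<Rightarrow> complex"
  assumes S: "open S" and hol: "\<And>n. f n holomorphic_on S"
    and bound: "\<And>n z. z \<in> S \<Longrightarrow> norm (f n z) \<le> B n" and B: "summable B"
  shows "(\<lambda>z. \<Sum>n. f n z) holomorphic_on S"
proof (rule holomorphic_uniform_sequence[OF S])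
  show "(\<lambda>z. \<Sum>i<n. f i z) holomorphic_on S" for n
    by (intro holomorphic_on_sum hol)
  fix z assume "z \<in> S"
  then obtain d where "d > 0" "cball z d \<subseteq> S" using S open_contains_cball by blast
  moreover have "uniform_limit S (\<lambda>n z. \<Sum>i<n. f i z) (\<lambda>z. \<Sum>n. f n z) sequentially"
    by (rule Weierstrass_m_test[OF bound B])
  ultimately show "\<exists>d>0. cball z d \<subseteq> S \<and>
      uniform_limit (cball z d) (\<lambda>n z. \<Sum>i<n. f i z) (\<lambda>z. \<Sum>n. f n z) sequentially"
    using uniform_limit_on_subset by blast
qed

text \<open>The sum is the inverse of \<open>1 - L\<close> applied to \<open>x\<close>; the last
  equation states this without naming the inverse.\<close>

lemma Neumann_series:
  fixes L :: "'a::banach \<Rightarrow> 'a"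
  assumes L: "bounded_linear L" and half: "\<And>x. norm (L x) \<le> norm x / 2"
  shows norm_funpow_le: "norm ((L ^^ j) x) \<le> (1/2)^j * norm x"
    and summable_funpow: "summable (\<lambda>j. (L ^^ j) x)"
    and suminf_funpow: "(\<Sum>j. (L ^^ j) x) = x + L (\<Sum>j. (L ^^ j) x)"
proof -
  show *: "norm ((L ^^ j) x) \<le> (1/2)^j * norm x" for j
  proof (induction j)
    case (Suc j)
    have "norm ((L ^^ Suc j) x) \<le> norm ((L ^^ j) x) / 2" using half by simp
    also have "\<dots> \<le> (1/2)^j * norm x / 2" using Suc by simp
    finally show ?case by simp
  qed simp
  have "summable (\<lambda>j. (1/2)^j * norm x)"
    by (intro summable_mult2 summable_geometric) simp
  then show sm: "summable (\<lambda>j. (L ^^ j) x)"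
    by (rule summable_comparison_test'[where N=0]) (rule *)
  have "(\<Sum>j. (L ^^ j) x) = x + (\<Sum>j. (L ^^ Suc j) x)"
    using suminf_split_head[OF sm] by simp
  also have "(\<Sum>j. (L ^^ Suc j) x) = L (\<Sum>j. (L ^^ j) x)"
    using bounded_linear.suminf[OF L sm] by simp
  finally show "(\<Sum>j. (L ^^ j) x) = x + L (\<Sum>j. (L ^^ j) x)" .
qed

lemma bounded_linear_scaleC: "bounded_linear (\<lambda>x. c *\<^sub>C (x::'a::complex_hilbert))"
  by (rule bounded_linear_intro[of _ "norm c"])
    (simp_all add: scaleC_add_right scaleR_scaleC scaleC_scaleC norm_scaleC mult.commute)

lemma scaleC_sum_right: "c *\<^sub>C (\<Sum>i\<in>J. f i) = (\<Sum>i\<in>J. c *\<^sub>C f i)"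
  for f :: "'i \<Rightarrow> 'a::complex_hilbert"
  by (rule linear_sum[OF bounded_linear.linear[OF bounded_linear_scaleC]])

lemma bounded_clinear_sum_scaleC:
  assumes "\<And>i. i \<in> J \<Longrightarrow> bounded_clinear (T i)"
  shows "bounded_clinear (\<lambda>x. \<Sum>i\<in>J. c i *\<^sub>C T i x)"
proof -
  have "bounded_linear (\<lambda>x. \<Sum>i\<in>J. c i *\<^sub>C T i x)"
    using assms unfolding bounded_clinear_def
    by (intro bounded_linear_sum bounded_linear_compose[OF bounded_linear_scaleC]) auto
  moreover have "(\<Sum>i\<in>J. c i *\<^sub>C T i (s *\<^sub>C x)) = s *\<^sub>C (\<Sum>i\<in>J. c i *\<^sub>C T i x)" for s x
    unfolding scaleC_sum_right using assms
    by (intro sum.cong) (auto simp: bounded_clinear_def scaleC_scaleC mult.commute)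
  ultimately show ?thesis by (simp add: bounded_clinear_def)
qed

text \<open>Relative to the coercive form \<open>a = M P - b t\<^sub>0\<close>, where \<open>P\<close> is the projection onto the span of the
  \<open>e l\<close>, the form \<open>b t\<close> is represented by the operator \<open>M P + L t - 1\<close> with \<open>L t\<close> small. Inverting
  \<open>1 - L t\<close> reduces its kernel to that of a matrix which is holomorphic in \<open>t\<close>.\<close>

lemma analytic_form_family_kernel:
  fixes h :: "'i \<Rightarrow> 'a::complex_hilbert \<Rightarrow> 'a \<Rightarrow> complex" and c :: "'i \<Rightarrow> real \<Rightarrow> real"
    and F :: "'i \<Rightarrow> complex \<Rightarrow> complex" and J :: "'i set" and e :: "nat \<Rightarrow> 'a"
  defines "b \<equiv> \<lambda>t x y. \<Sum>i\<in>J. of_real (c i t) * h i x y"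
  assumes J: "finite J" and h: "\<And>i. i \<in> J \<Longrightarrow> hermitian_form (h i)"
    and r: "r > 0" and F: "\<And>i. i \<in> J \<Longrightarrow> F i holomorphic_on ball (of_real t\<^sub>0) r"
    and Fc: "\<And>i t. i \<in> J \<Longrightarrow> t \<in> I \<Longrightarrow> \<bar>t - t\<^sub>0\<bar> < r \<Longrightarrow> F i (of_real t) = of_real (c i t)"
    and t0: "t\<^sub>0 \<in> I" and neg: "\<And>t x. t \<in> I \<Longrightarrow> Re (b t x x) \<le> 0" and \<kappa>: "\<kappa> > 0"
    and coercive: "\<And>x. \<kappa> * (norm x)\<^sup>2 \<le> M * (\<Sum>l<m. (norm (cinner x (e l)))\<^sup>2) - Re (b t\<^sub>0 x x)"
  shows "\<exists>\<epsilon>>0. \<exists>d. d holomorphic_on ball (of_real t\<^sub>0) \<epsilon> \<and>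
    (\<forall>t\<in>I. \<bar>t - t\<^sub>0\<bar> < \<epsilon> \<longrightarrow> (d (of_real t) = 0 \<longleftrightarrow> (\<exists>x. x \<noteq> 0 \<and> Re (b t x x) = 0)))"
proof -
  define z0 where "z0 = complex_of_real t\<^sub>0"
  have b: "hermitian_form (b t)" for t
    unfolding b_def by (intro hermitian_form_sum hermitian_form_of_real_mult h)
  define a where "a x y = of_real M * (\<Sum>l<m. cinner x (e l) * cinner (e l) y) + of_real (-1) * b t\<^sub>0 x y" for x y
  have a: "hermitian_form a"
    unfolding a_def
    by (intro hermitian_form_add hermitian_form_of_real_mult hermitian_form_sum hermitian_form_rank_one b)
  have "cinner x (e l) * cinner (e l) x = of_real ((norm (cinner x (e l)))\<^sup>2)" for x l
    by (subst (2) cinner_commute) (simp add: complex_norm_square del: of_real_power)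
  then have "(\<Sum>l<m. cinner x (e l) * cinner (e l) x) = of_real (\<Sum>l<m. (norm (cinner x (e l)))\<^sup>2)" for x
    by (simp del: of_real_power)
  then have a_coercive: "\<kappa> * (norm x)\<^sup>2 \<le> Re (a x x)" for x
    using coercive[of x] unfolding a_def by simp
  have a_nondeg: "u = 0" if "\<And>y. a u y = 0" for u
    using a_coercive[of u] that[of u] \<kappa> by (simp add: mult_le_0_iff)
  have "\<forall>i\<in>J. \<exists>T. bounded_clinear T \<and> (\<forall>x y. a (T x) y = h i x y)"
    using form_representing_operator[OF a \<kappa> a_coercive h] by blast
  then obtain T where "\<forall>i\<in>J. bounded_clinear (T i) \<and> (\<forall>x y. a (T i x) y = h i x y)"
    by (rule bchoice[THEN exE])
  then have T: "\<And>i. i \<in> J \<Longrightarrow> bounded_clinear (T i)"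
    and aT: "\<And>i x y. i \<in> J \<Longrightarrow> a (T i x) y = h i x y" by blast+
  obtain E where aE: "\<And>x y. a (E x) y = cinner x y"
    using form_representing_operator[OF a \<kappa> a_coercive hermitian_form_cinner] by blast
  \<comment> \<open>In the inner product \<open>a\<close> the functional
    \<open>cinner _ (e l)\<close> is represented by \<open>w l\<close>, so the projection term
    becomes a combination of the \<open>w l\<close>.\<close>
  define w where "w l = E (e l)" for l
  have a_w: "a (w l) y = cinner (e l) y" for l y by (simp add: w_def aE)
  have a_w': "a x (w l) = cinner x (e l)" for l x
    by (subst hermitian_form_commute[OF a]) (simp add: a_w cinner_commute[of x])

  have "\<forall>i\<in>J. \<exists>K. K > 0 \<and> (\<forall>x. norm (T i x) \<le> norm x * K)"
    using T bounded_linear.pos_bounded unfolding bounded_clinear_def by blast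
  then obtain K where "\<forall>i\<in>J. K i > 0 \<and> (\<forall>x. norm (T i x) \<le> norm x * K i)"
    by (rule bchoice[THEN exE])
  then have K: "\<And>i. i \<in> J \<Longrightarrow> K i > 0" "\<And>i x. i \<in> J \<Longrightarrow> norm (T i x) \<le> norm x * K i"
    by blast+
  \<comment> \<open>Chosen so that \<open>k * sum K J\<close> is at most 1/2, the contraction
    constant of \<open>L z\<close>; the added 1 keeps the denominator positive when the sum
    vanishes.\<close>
  define k where "k = 1 / (2 * (1 + sum K J))"
  have sK: "sum K J \<ge> 0" using K by (intro sum_nonneg) (auto intro: less_imp_le)
  then have k: "k > 0" by (simp add: k_def)
  have "\<forall>\<^sub>F z in nhds z0. \<forall>i\<in>J. norm (F i z - F i z0) < k"
  proof (intro eventually_ball_finite J ballI)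
    fix i assume "i \<in> J"
    then have "continuous_on (ball z0 r) (F i)"
      unfolding z0_def by (intro holomorphic_on_imp_continuous_on F)
    then have "isCont (F i) z0" using r by (simp add: continuous_on_eq_continuous_at)
    then have "(F i \<longlongrightarrow> F i z0) (nhds z0)" by (simp add: isCont_def tendsto_at_iff_tendsto_nhds)
    then show "\<forall>\<^sub>F z in nhds z0. norm (F i z - F i z0) < k"
      using k by (auto dest!: tendstoD simp: dist_norm)
  qed
  then obtain \<epsilon>' where "\<epsilon>' > 0" and \<epsilon>': "\<And>z i. dist z z0 < \<epsilon>' \<Longrightarrow> i \<in> J \<Longrightarrow> norm (F i z - F i z0) < k"
    unfolding eventually_nhds_metric by blast
  define \<epsilon> where "\<epsilon> = min r \<epsilon>'"
  have \<epsilon>: "\<epsilon> > 0" using r \<open>\<epsilon>' > 0\<close> by (simp add: \<epsilon>_def)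
  have small: "norm (F i z - F i z0) < k" if "z \<in> ball z0 \<epsilon>" "i \<in> J" for z i
    using that \<epsilon>' by (simp add: \<epsilon>_def dist_commute)

  \<comment> \<open>At real parameters this represents \<open>b t - b t\<^sub>0\<close> with respect
    to \<open>a\<close>; at other \<open>z\<close> it is linear but in general no longer
    symmetric.\<close>
  define L where "L z x = (\<Sum>i\<in>J. (F i z - F i z0) *\<^sub>C T i x)" for z x
  have L: "bounded_clinear (L z)" for z
    unfolding L_def by (intro bounded_clinear_sum_scaleC T)
  then have L_lin: "bounded_linear (L z)" for z by (simp add: bounded_clinear_def)
  have half: "norm (L z x) \<le> norm x / 2" if z: "z \<in> ball z0 \<epsilon>" for z x
  proof -
    have "norm (L z x) \<le> (\<Sum>i\<in>J. k * (norm x * K i))"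
      unfolding L_def
    proof (rule order_trans[OF norm_sum sum_mono])
      fix i assume i: "i \<in> J"
      show "norm ((F i z - F i z0) *\<^sub>C T i x) \<le> k * (norm x * K i)"
        unfolding norm_scaleC using small[OF z i] K(2)[OF i, of x] k by (intro mult_mono) auto
    qed
    also have "\<dots> = norm x * (k * sum K J)" by (simp add: sum_distrib_left mult_ac)
    also have "\<dots> \<le> norm x * (1/2)"
      using sK by (intro mult_left_mono) (auto simp: k_def field_simps)
    finally show ?thesis by simp
  qed
  have aL: "a (L z x) y = (\<Sum>i\<in>J. (F i z - F i z0) * h i x y)" for z x y
    unfolding L_def hermitian_form_sum_left[OF a]
    by (intro sum.cong) (simp_all add: hermitian_form_scaleC_left[OF a] aT)
  \<comment> \<open>Holomorphy is only needed weakly. Each \<open>T i\<close> is symmetric for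
    \<open>a\<close>, so one factor of the power moves into the second argument; hence the induction
    over arbitrary \<open>y\<close>.\<close>
  have hol_pow: "(\<lambda>z. a ((L z ^^ j) x) y) holomorphic_on ball z0 \<epsilon>" for j x y
  proof (induction j arbitrary: y)
    case (Suc j)
    have "h i u y = a u (T i y)" if "i \<in> J" for i u
      using aT[OF that, of y u] hermitian_form_commute[OF a, of u "T i y"]
        hermitian_form_commute[OF h[OF that], of u y] by simp
    then have "a ((L z ^^ Suc j) x) y = (\<Sum>i\<in>J. (F i z - F i z0) * a ((L z ^^ j) x) (T i y))" for z
      by (simp add: aL)
    moreover have "F i holomorphic_on ball z0 \<epsilon>" if "i \<in> J" for i
      using F[OF that] by (rule holomorphic_on_subset) (auto simp: \<epsilon>_def z0_def)
    ultimately show ?case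
      by (simp only:) (intro holomorphic_on_sum holomorphic_on_mult holomorphic_on_diff
          holomorphic_on_const Suc; simp)
  qed simp

  \<comment> \<open>The inverse of \<open>1 - L z\<close> applied to \<open>w l\<close>.\<close>
  define V where "V z l = (\<Sum>j. (L z ^^ j) (w l))" for z l
  have V: "V z l = w l + L z (V z l)" if "z \<in> ball z0 \<epsilon>" for z l
    unfolding V_def by (rule suminf_funpow[OF L_lin half[OF that]])
  \<comment> \<open>A null vector \<open>x\<close> is the combination of the \<open>V z j\<close>
    with coefficients \<open>M * \<xi> j\<close>, where \<open>\<xi> j = cinner x (e j)\<close>.
    Taking the inner product with each \<open>e l\<close> gives the homogeneous system with matrix
    \<open>N\<close>.\<close>
  define N where "N l j z = (if l = j then 1 else 0) - of_real M * a (V z j) (w l)" for l j z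
  have "(\<lambda>z. a (V z j) (w l)) holomorphic_on ball z0 \<epsilon>" for l j
  proof -
    obtain B where B: "\<And>x y. norm (a x y) \<le> B * norm x * norm y" "B > 0"
      using hermitian_form_bound[OF a] by blast
    have "(\<lambda>z. \<Sum>n. a ((L z ^^ n) (w j)) (w l)) holomorphic_on ball z0 \<epsilon>"
    proof (rule holomorphic_on_suminf[where B = "\<lambda>n. B * ((1/2)^n * norm (w j)) * norm (w l)"])
      show "norm (a ((L z ^^ n) (w j)) (w l)) \<le> B * ((1/2)^n * norm (w j)) * norm (w l)"
        if "z \<in> ball z0 \<epsilon>" for n z
        using norm_funpow_le[OF L_lin half[OF that], of n "w j"] \<open>B > 0\<close>
        by (intro order_trans[OF B(1)] mult_right_mono mult_left_mono) auto
      show "summable (\<lambda>n. B * ((1/2)^n * norm (w j)) * norm (w l))"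
        by (intro summable_mult summable_mult2 summable_geometric) simp
    qed (simp_all add: hol_pow)
    moreover have "(\<Sum>n. a ((L z ^^ n) (w j)) (w l)) = a (V z j) (w l)" if "z \<in> ball z0 \<epsilon>" for z
      unfolding V_def
      using bounded_linear.suminf[OF hermitian_form_bounded_linear_left[OF a] summable_funpow[OF L_lin half[OF that]]]
      by simp
    ultimately show ?thesis by (rule holomorphic_transform)
  qed
  then have "N l j holomorphic_on ball z0 \<epsilon>" for l j
    unfolding N_def[abs_def] by (intro holomorphic_intros)
  then obtain d where d: "d holomorphic_on ball z0 \<epsilon>"
    and d0: "\<And>z. d z = 0 \<longleftrightarrow> (\<exists>\<xi>. (\<exists>j<m. \<xi> j \<noteq> 0) \<and> (\<forall>l<m. (\<Sum>j<m. N l j z * \<xi> j) = 0))"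
    using holomorphic_singular_locus[of m N "ball z0 \<epsilon>"] by blast

  \<comment> \<open>\<open>W \<xi>\<close> is the projection term, scaled by \<open>M\<close>, of
    any vector whose coefficients are \<xi>; \<open>U z \<xi>\<close> below solves
    \<open>u = W \<xi> + L z u\<close>.\<close>
  define W where "W \<xi> = (\<Sum>l<m. (of_real M * \<xi> l) *\<^sub>C w l)" for \<xi>
  define U where "U z \<xi> = (\<Sum>l<m. (of_real M * \<xi> l) *\<^sub>C V z l)" for z \<xi>
  have U: "U z \<xi> = W \<xi> + L z (U z \<xi>)" if "z \<in> ball z0 \<epsilon>" for z \<xi>
  proof -
    have "L z (U z \<xi>) = (\<Sum>l<m. (of_real M * \<xi> l) *\<^sub>C L z (V z l))"
      unfolding U_def linear_sum[OF bounded_linear.linear[OF L_lin]]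
      by (simp add: bounded_clinear_simps[OF L])
    then have "W \<xi> + L z (U z \<xi>) = (\<Sum>l<m. (of_real M * \<xi> l) *\<^sub>C (w l + L z (V z l)))"
      by (simp add: W_def scaleC_add_right sum.distrib)
    also have "\<dots> = U z \<xi>" by (simp add: U_def flip: V[OF that])
    finally show ?thesis by simp
  qed
  have NU: "(\<Sum>j<m. N l j z * \<xi> j) = \<xi> l - cinner (U z \<xi>) (e l)" if "l < m" for l z \<xi>
  proof -
    have "(\<Sum>j<m. N l j z * \<xi> j)
        = (\<Sum>j<m. (if l = j then \<xi> j else 0) - of_real M * \<xi> j * a (V z j) (w l))"
      by (intro sum.cong) (auto simp: N_def algebra_simps)
    also have "\<dots> = \<xi> l - (\<Sum>j<m. of_real M * \<xi> j * a (V z j) (w l))"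
      using that by (simp add: sum_subtractf)
    also have "(\<Sum>j<m. of_real M * \<xi> j * a (V z j) (w l)) = a (U z \<xi>) (w l)"
      by (simp add: U_def hermitian_form_sum_left[OF a] hermitian_form_scaleC_left[OF a])
    finally show ?thesis by (simp add: a_w')
  qed
  have fixed: "x = 0" if "z \<in> ball z0 \<epsilon>" "L z x = x" for z x
    using half[OF that(1), of x] that(2) by simp
  have "d (of_real t) = 0 \<longleftrightarrow> (\<exists>x. x \<noteq> 0 \<and> Re (b t x x) = 0)" if t: "t \<in> I" "\<bar>t - t\<^sub>0\<bar> < \<epsilon>" for t
  proof -
    define z where "z = complex_of_real t"
    have z: "z \<in> ball z0 \<epsilon>" using t(2) by (simp add: z_def z0_def dist_of_real dist_real_def abs_minus_commute)
    have bt: "b t x y = a (W (\<lambda>l. cinner x (e l)) + L z x - x) y" for x y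
    proof -
      have "a (L z x) y = b t x y - b t\<^sub>0 x y"
        unfolding aL b_def sum_subtractf[symmetric] using t t0 r
        by (intro sum.cong) (auto simp: z_def z0_def Fc \<epsilon>_def algebra_simps)
      moreover have "a (W (\<lambda>l. cinner x (e l))) y = of_real M * (\<Sum>l<m. cinner x (e l) * cinner (e l) y)"
        by (simp add: W_def hermitian_form_sum_left[OF a] hermitian_form_scaleC_left[OF a] a_w
            sum_distrib_left mult.assoc)
      moreover have "a x y = of_real M * (\<Sum>l<m. cinner x (e l) * cinner (e l) y) - b t\<^sub>0 x y"
        by (simp add: a_def)
      ultimately show ?thesis by (simp add: hermitian_form_simps[OF a])
    qed
    show ?thesis
    proof
      assume "d (of_real t) = 0"
      then obtain \<xi> j where \<xi>: "j < m" "\<xi> j \<noteq> 0" "\<And>l. l < m \<Longrightarrow> (\<Sum>j<m. N l j z * \<xi> j) = 0"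
        unfolding d0 z_def by blast
      define u where "u = U z \<xi>"
      have u: "cinner u (e l) = \<xi> l" if "l < m" for l
        using \<xi>(3)[OF that] NU[OF that] by (simp add: u_def)
      then have "W (\<lambda>l. cinner u (e l)) = W \<xi>" by (simp add: W_def)
      then have "b t u u = 0"
        using U[OF z, of \<xi>] unfolding bt by (simp add: hermitian_form_zero_left[OF a] flip: u_def)
      moreover have "u \<noteq> 0" using u[OF \<xi>(1)] \<xi>(2) by (auto simp: cinner_simps)
      ultimately show "\<exists>x. x \<noteq> 0 \<and> Re (b t x x) = 0" by (intro exI[of _ u]) simp
    next
      assume "\<exists>x. x \<noteq> 0 \<and> Re (b t x x) = 0"
      then obtain x where x: "x \<noteq> 0" "Re (b t x x) = 0" by blast
      define \<xi> where "\<xi> l = cinner x (e l)" for l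
      \<comment> \<open>Semidefiniteness is what turns the vanishing of the quadratic form into the
        linear null equation.\<close>
      have "b t x y = 0" for y by (rule semidefinite_form_null[OF b neg[OF t(1)] x(2)])
      then have "W \<xi> + L z x - x = 0" unfolding bt \<xi>_def by (rule a_nondeg)
      then have x_eq: "x = W \<xi> + L z x" by simp
      have "L z (x - U z \<xi>) = x - U z \<xi>"
        unfolding bounded_clinear_simps[OF L] using x_eq U[OF z, of \<xi>]
        by (metis add_diff_cancel_left)
      then have "x = U z \<xi>" using fixed[OF z] by (metis eq_iff_diff_eq_0)
      then have "(\<Sum>j<m. N l j z * \<xi> j) = 0" if "l < m" for l
        using NU[OF that, of z \<xi>] by (simp add: \<xi>_def)
      moreover have "\<exists>j<m. \<xi> j \<noteq> 0"
      proof (rule ccontr)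
        assume "\<not> (\<exists>j<m. \<xi> j \<noteq> 0)"
        then have "W \<xi> = 0" by (simp add: W_def)
        then show False using x_eq fixed[OF z, of x] x(1) by simp
      qed
      ultimately show "d (of_real t) = 0" unfolding d0 z_def by blast
    qed
  qed
  with \<epsilon> d show ?thesis
    unfolding z0_def by (intro exI[of _ \<epsilon>] exI[of _ d] conjI ballI impI)
qed

subsection \<open>Real-analytic functions on intervals\<close>

lemma interval_islimpt:
  fixes I :: "real set"
  assumes "is_interval I" "interior I \<noteq> {}" "t \<in> I"
  shows "t islimpt I"
proof (rule connected_imp_perfect)
  show "connected I" using assms(1) by (simp add: is_interval_connected)
  show "I \<noteq> {x}" for x using assms(2) by auto
qed fact

text \<open>The identity theorem: zeros on the real line that accumulate at the centre also
  accumulate there in the complex disc.\<close>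

lemma analytic_zero_propagation:
  assumes F: "F holomorphic_on ball (complex_of_real t\<^sub>0) r" and r: "r > 0" and lim: "t\<^sub>0 islimpt Z"
    and zero: "\<And>t. t \<in> Z \<Longrightarrow> \<bar>t - t\<^sub>0\<bar> < r \<Longrightarrow> F (of_real t) = 0"
    and t: "\<bar>t - t\<^sub>0\<bar> < r"
  shows "F (of_real t) = 0"
proof (rule analytic_continuation[OF F])
  have "\<forall>\<^sub>F t in at t\<^sub>0. t \<in> ball t\<^sub>0 r"
    using r by (intro eventually_at_in_open') auto
  then have "t\<^sub>0 islimpt Z \<inter> ball t\<^sub>0 r" by (rule islimpt_Int_eventually[OF lim])
  then show "of_real t\<^sub>0 islimpt complex_of_real ` (Z \<inter> ball t\<^sub>0 r)"
    by (intro islimpt_isCont_image) (auto simp: eventually_at_filter)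
  show "complex_of_real ` (Z \<inter> ball t\<^sub>0 r) \<subseteq> ball (of_real t\<^sub>0) r"
    by (auto simp: dist_of_real)
  show "of_real t \<in> ball (complex_of_real t\<^sub>0) r"
    using t by (simp add: dist_of_real dist_real_def abs_minus_commute)
  show "F z = 0" if "z \<in> complex_of_real ` (Z \<inter> ball t\<^sub>0 r)" for z
    using that zero by (auto simp: dist_real_def abs_minus_commute)
qed (use r in auto)

text \<open>\<open>Z\<close> itself may have isolated points, so the clopen argument is run with its
  limit points in \<open>I\<close>: they are closed in \<open>I\<close>, and open by
  \<open>step\<close> because \<open>I\<close> has no isolated points.\<close>

lemma limit_point_propagation:
  fixes I :: "real set"
  assumes I: "is_interval I" "interior I \<noteq> {}" and s: "s \<in> I" "s islimpt Z"
    and step: "\<And>t\<^sub>0. t\<^sub>0 \<in> I \<Longrightarrow> t\<^sub>0 islimpt Z \<Longrightarrow> \<exists>\<epsilon>>0. \<forall>t\<in>I. \<bar>t - t\<^sub>0\<bar> < \<epsilon> \<longrightarrow> t \<in> Z"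
  shows "I \<subseteq> Z"
proof -
  define L where "L = I \<inter> {t. t islimpt Z}"
  have "closedin (top_of_set I) L"
    unfolding L_def by (rule closedin_closed_Int[OF closed_limpts])
  moreover have "openin (top_of_set I) L"
    unfolding openin_contains_ball
  proof (intro conjI ballI)
    show "L \<subseteq> I" by (simp add: L_def)
    fix t\<^sub>0 assume "t\<^sub>0 \<in> L"
    then obtain \<epsilon> where \<epsilon>: "\<epsilon> > 0" "\<And>t. t \<in> I \<Longrightarrow> \<bar>t - t\<^sub>0\<bar> < \<epsilon> \<Longrightarrow> t \<in> Z"
      using step unfolding L_def by blast
    have "t islimpt Z" if t: "t \<in> I" "t \<in> ball t\<^sub>0 \<epsilon>" for t
    proof -
      have "t islimpt I" by (rule interval_islimpt[OF I t(1)])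
      moreover have "\<forall>\<^sub>F u in at t. u \<in> ball t\<^sub>0 \<epsilon>"
        using t(2) by (intro eventually_at_in_open') auto
      ultimately have "t islimpt I \<inter> ball t\<^sub>0 \<epsilon>" by (rule islimpt_Int_eventually)
      then show ?thesis
        by (rule islimpt_subset) (auto intro!: \<epsilon>(2) simp: dist_real_def abs_minus_commute)
    qed
    then show "\<exists>e>0. ball t\<^sub>0 e \<inter> I \<subseteq> L" using \<epsilon>(1) unfolding L_def by blast
  qed
  moreover have "connected I" using I(1) by (simp add: is_interval_connected)
  moreover have "s \<in> L" using s by (simp add: L_def)
  ultimately have "L = I" unfolding connected_clopen by blast
  show "I \<subseteq> Z"
  proof
    fix t assume t: "t \<in> I"
    then have "t islimpt Z" using \<open>L = I\<close> by (auto simp: L_def)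
    from step[OF t this] t show "t \<in> Z" by auto
  qed
qed

text \<open>Convergence of the power series at one further point \<open>t1\<close> of
  \<open>I\<close> forces convergence in the disc of radius
  \<open>\<bar>t1 - t\<^sub>0\<bar>\<close>, even if \<open>I\<close> lies on one side of
  \<open>t\<^sub>0\<close>.\<close>

lemma real_analytic_extension:
  assumes \<gamma>: "real_analytic_on \<gamma> I" and I: "is_interval I" "interior I \<noteq> {}" and t0: "t\<^sub>0 \<in> I"
  shows "\<exists>r>0. \<exists>G. G holomorphic_on ball (of_real t\<^sub>0) r \<and>
    (\<forall>t\<in>I. \<bar>t - t\<^sub>0\<bar> < r \<longrightarrow> G (of_real t) = \<gamma> t \<and>
      (\<gamma> has_vector_derivative deriv G (of_real t)) (at t within I))"
proof -
  obtain r0 c where "r0 > 0"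
    and c: "\<And>t. t \<in> I \<Longrightarrow> \<bar>t - t\<^sub>0\<bar> < r0 \<Longrightarrow> (\<lambda>n. c n * of_real (t - t\<^sub>0) ^ n) sums \<gamma> t"
    using \<gamma> t0 unfolding real_analytic_on_def by blast
  have "t\<^sub>0 islimpt I" by (rule interval_islimpt[OF I t0])
  then obtain t1 where t1: "t1 \<in> I" "t1 \<noteq> t\<^sub>0" "\<bar>t1 - t\<^sub>0\<bar> < r0"
    using \<open>r0 > 0\<close> unfolding islimpt_approachable dist_real_def by blast
  define r where "r = \<bar>t1 - t\<^sub>0\<bar>"
  have r: "r > 0" "r < r0" using t1 by (auto simp: r_def)
  define G where "G z = (\<Sum>n. c n * (z - of_real t\<^sub>0) ^ n)" for z
  have "G holomorphic_on ball (of_real t\<^sub>0) r"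
  proof (rule power_series_holomorphic)
    fix z assume "z \<in> ball (complex_of_real t\<^sub>0) r"
    then have "norm (z - of_real t\<^sub>0) < norm (complex_of_real (t1 - t\<^sub>0))"
      by (simp add: r_def dist_norm norm_minus_commute del: of_real_diff)
    then have "summable (\<lambda>n. c n * (z - of_real t\<^sub>0) ^ n)"
      by (rule powser_inside[OF sums_summable[OF c[OF t1(1,3)]]])
    then show "(\<lambda>n. c n * (z - of_real t\<^sub>0) ^ n) sums G z" unfolding G_def by (rule summable_sums)
  qed
  moreover have G: "G (of_real t) = \<gamma> t" if "t \<in> I" "\<bar>t - t\<^sub>0\<bar> < r" for t
    using c[of t] that r unfolding G_def by (simp add: sums_iff)
  moreover have "(\<gamma> has_vector_derivative deriv G (of_real t)) (at t within I)"
    if t: "t \<in> I" "\<bar>t - t\<^sub>0\<bar> < r" for t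
  proof (rule has_vector_derivative_transform_within)
    have "of_real t \<in> ball (complex_of_real t\<^sub>0) r"
      using t by (simp add: dist_of_real dist_real_def abs_minus_commute)
    with calculation(1) have "(G has_field_derivative deriv G (of_real t)) (at (of_real t))"
      by (intro holomorphic_derivI) auto
    then show "((\<lambda>t. G (of_real t)) has_vector_derivative deriv G (of_real t)) (at t within I)"
      by (rule has_vector_derivative_real_field)
    show "0 < r - \<bar>t - t\<^sub>0\<bar>" using t by simp
    show "G (of_real s) = \<gamma> s" if "s \<in> I" "dist s t < r - \<bar>t - t\<^sub>0\<bar>" for s
      using that by (intro G) (auto simp: dist_real_def)
  qed fact
  ultimately show ?thesis using r(1) by blast
qed

text \<open>The reflected function \<open>cnj (G (cnj z))\<close> is holomorphic and equals the
  conjugate of \<open>G\<close> on the real axis. Real inner products along the curve are extended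
  to complex parameters in this way.\<close>

lemma holomorphic_Re_Im_extension:
  assumes G: "G holomorphic_on ball (complex_of_real t\<^sub>0) r"
  shows "\<exists>U V. U holomorphic_on ball (complex_of_real t\<^sub>0) r \<and> V holomorphic_on ball (complex_of_real t\<^sub>0) r \<and>
    (\<forall>t. U (of_real t) = of_real (Re (G (of_real t))) \<and> V (of_real t) = of_real (Im (G (of_real t))))"
proof (intro exI conjI allI)
  have "cnj z \<in> ball (of_real t\<^sub>0) r" if "z \<in> ball (of_real t\<^sub>0) r" for z
    using that by (metis complex_cnj_complex_of_real complex_cnj_diff complex_mod_cnj dist_norm mem_ball)
  then have "cnj ` ball (of_real t\<^sub>0) r \<subseteq> ball (of_real t\<^sub>0) r" by blast
  then have "cnj \<circ> G \<circ> cnj holomorphic_on ball (of_real t\<^sub>0) r"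
    by (intro holomorphic_on_compose_cnj_cnj holomorphic_on_subset[OF G]) auto
  then have G': "(\<lambda>z. cnj (G (cnj z))) holomorphic_on ball (of_real t\<^sub>0) r" by (simp add: o_def)
  show "(\<lambda>z. (G z + cnj (G (cnj z))) / 2) holomorphic_on ball (of_real t\<^sub>0) r"
    "(\<lambda>z. (G z - cnj (G (cnj z))) / (2 * \<i>)) holomorphic_on ball (of_real t\<^sub>0) r"
    by (intro holomorphic_intros G G'; simp)+
  show "(G (of_real t) + cnj (G (cnj (of_real t)))) / 2 = of_real (Re (G (of_real t)))"
    "(G (of_real t) - cnj (G (cnj (of_real t)))) / (2 * \<i>) = of_real (Im (G (of_real t)))" for t
    by (simp_all add: complex_eq_iff)
qed

subsection \<open>Convex domains bounded by an analytic curve\<close>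

text \<open>From a point of an open set one can still move a little in direction \<open>n\<close>,
  so equality would violate the weak inequality.\<close>

lemma open_half_plane_strict:
  fixes n :: "'a::real_inner"
  assumes D: "open D" and n: "n \<noteq> 0" and weak: "\<And>y. y \<in> D \<Longrightarrow> n \<bullet> (y - p) \<le> 0" and y: "y \<in> D"
  shows "n \<bullet> (y - p) < 0"
proof -
  obtain e where e: "e > 0" "cball y e \<subseteq> D" using D y open_contains_cball by blast
  define y' where "y' = y + (e / norm n) *\<^sub>R n"
  have "y' \<in> D" using e n by (intro subsetD[OF e(2)]) (simp add: y'_def dist_norm)
  then have "n \<bullet> (y - p) + e / norm n * (n \<bullet> n) \<le> 0"
    using weak[of y'] by (simp add: y'_def inner_simps)
  moreover have "e / norm n * (n \<bullet> n) > 0" using e(1) n by simp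
  ultimately show ?thesis by linarith
qed

text \<open>The product being positive and real means that \<open>x\<close> and \<open>y\<close> lie
  on one ray from \<open>c\<close>. If they differed, the nearer one would lie in the open segment
  from \<open>c\<close> to the other, which is interior to \<open>D\<close>.\<close>

lemma frontier_ray_unique:
  fixes x y c :: complex
  assumes D: "convex D" "open D" and c: "c \<in> D" and x: "x \<in> frontier D" and y: "y \<in> frontier D"
    and Im: "Im ((x - c) * cnj (y - c)) = 0" and Re: "Re ((x - c) * cnj (y - c)) > 0"
  shows "x = y"
proof -
  have inner: False if "u \<in> frontier D" "v \<in> frontier D" "u - c = k *\<^sub>R (v - c)" "0 < k" "k < 1" for u v k
  proof -
    have "u = (1 - k) *\<^sub>R c + k *\<^sub>R v" using that(3) by (simp add: algebra_simps)
    moreover have "c \<noteq> v" using that(2) c D(2) by (auto simp: frontier_def interior_open)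
    ultimately have "u \<in> open_segment c v" using that(4,5) unfolding in_segment by blast
    moreover have "open_segment c v \<subseteq> interior D"
      using that(2) c D by (intro in_interior_closure_convex_segment) (auto simp: frontier_def interior_open)
    ultimately show False using that(1) by (auto simp: frontier_def)
  qed
  have yc: "y - c \<noteq> 0" using Re by auto
  define k where "k = Re ((x - c) * cnj (y - c)) / (norm (y - c))\<^sup>2"
  have k: "k > 0" using Re yc by (simp add: k_def)
  have "(x - c) * cnj (y - c) = of_real (k * (norm (y - c))\<^sup>2)"
    using Im yc by (simp add: complex_eq_iff k_def)
  then have "(x - c) * cnj (y - c) = k * (y - c) * cnj (y - c)"
    by (simp add: complex_norm_square[unfolded of_real_power] mult.assoc)
  then have xk: "x - c = k *\<^sub>R (y - c)" using yc by (simp add: scaleR_conv_of_real)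
  have "\<not> k < 1" using inner[OF x y xk k] by blast
  moreover have "\<not> k > 1"
  proof
    assume "k > 1"
    with xk k show False by (intro inner[OF y x, of "1 / k"]) simp_all
  qed
  ultimately show ?thesis using xk by simp
qed

locale analytic_convex_domain =
  fixes D :: "complex set" and I :: "real set" and \<gamma> :: "real \<Rightarrow> complex"
  assumes D: "bounded D" "open D" "convex D"
    and I: "is_interval I" "interior I \<noteq> {}"
    and analytic: "real_analytic_on \<gamma> I"
    and regular: "\<And>t. t \<in> I \<Longrightarrow> vector_derivative \<gamma> (at t within I) \<noteq> 0"
    and frontier_eq: "frontier D = \<gamma> ` I"
begin

definition tangent :: "real \<Rightarrow> complex"
  where "tangent t = vector_derivative \<gamma> (at t within I)"

lemma tangent_nonzero: "t \<in> I \<Longrightarrow> tangent t \<noteq> 0"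
  using regular by (simp add: tangent_def)

text \<open>As \<open>I\<close> has no isolated points, the derivative within \<open>I\<close> is
  unique and must agree with that of the extension.\<close>

lemma holomorphic_extension:
  assumes "t\<^sub>0 \<in> I"
  shows "\<exists>r>0. \<exists>G. G holomorphic_on ball (of_real t\<^sub>0) r \<and>
    (\<forall>t\<in>I. \<bar>t - t\<^sub>0\<bar> < r \<longrightarrow> G (of_real t) = \<gamma> t \<and> deriv G (of_real t) = tangent t)"
  and has_tangent: "(\<gamma> has_vector_derivative tangent t\<^sub>0) (at t\<^sub>0 within I)"
proof -
  obtain r G where r: "r > 0" and G: "G holomorphic_on ball (of_real t\<^sub>0) r"
    and *: "\<And>t. t \<in> I \<Longrightarrow> \<bar>t - t\<^sub>0\<bar> < r \<Longrightarrow> G (of_real t) = \<gamma> t"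
    "\<And>t. t \<in> I \<Longrightarrow> \<bar>t - t\<^sub>0\<bar> < r \<Longrightarrow> (\<gamma> has_vector_derivative deriv G (of_real t)) (at t within I)"
    using real_analytic_extension[OF analytic I assms] by blast
  have eq: "deriv G (of_real t) = tangent t" if "t \<in> I" "\<bar>t - t\<^sub>0\<bar> < r" for t
    unfolding tangent_def using interval_islimpt[OF I that(1)]
    by (intro vector_derivative_within[symmetric] *(2) that) (simp add: trivial_limit_within)
  then show "\<exists>r>0. \<exists>G. G holomorphic_on ball (of_real t\<^sub>0) r \<and>
    (\<forall>t\<in>I. \<bar>t - t\<^sub>0\<bar> < r \<longrightarrow> G (of_real t) = \<gamma> t \<and> deriv G (of_real t) = tangent t)"
    using r G * by blast
  show "(\<gamma> has_vector_derivative tangent t\<^sub>0) (at t\<^sub>0 within I)"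
    using *(2)[OF assms] eq[OF assms] r by simp
qed

lemma continuous_on_curve: "continuous_on I \<gamma>"
  using has_vector_derivative_continuous[OF has_tangent]
  by (simp add: continuous_on_eq_continuous_within)

lemma continuous_on_tangent: "continuous_on I tangent"
  unfolding continuous_on_eq_continuous_within
proof
  fix t\<^sub>0 assume t0: "t\<^sub>0 \<in> I"
  obtain r G where r: "r > 0" and G: "G holomorphic_on ball (of_real t\<^sub>0) r"
    and eq: "\<And>t. t \<in> I \<Longrightarrow> \<bar>t - t\<^sub>0\<bar> < r \<Longrightarrow> deriv G (of_real t) = tangent t"
    using holomorphic_extension[OF t0] by blast
  have "continuous_on (ball (of_real t\<^sub>0) r) (deriv G)"
    by (intro holomorphic_on_imp_continuous_on holomorphic_deriv G) simp
  then have "isCont (deriv G) (of_real t\<^sub>0)" using r by (simp add: continuous_on_eq_continuous_at)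
  then have "((\<lambda>t. deriv G (of_real t)) \<longlongrightarrow> deriv G (of_real t\<^sub>0)) (at t\<^sub>0 within I)"
    by (rule isCont_tendsto_compose) (intro tendsto_intros)
  then have "continuous (at t\<^sub>0 within I) (\<lambda>t. deriv G (of_real t))"
    by (simp add: continuous_within)
  then show "continuous (at t\<^sub>0 within I) tangent"
    by (rule continuous_transform_within[OF _ r t0]) (simp add: eq dist_real_def)
qed

text \<open>At an interior parameter every supporting line is tangent to the curve. At an endpoint of
  \<open>I\<close> the domain may have a corner, and the one-sided tangent is supporting by continuity.\<close>

lemma oriented_normal:
  assumes "D \<noteq> {}"
  shows "\<exists>\<sigma>::real. \<forall>t\<in>I. \<forall>y\<in>D. (\<sigma> *\<^sub>R (\<i> * tangent t)) \<bullet> (y - \<gamma> t) < 0"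
proof -
  obtain c where c: "c \<in> D" using assms by blast
  define w where "w t y = (\<i> * tangent t) \<bullet> (y - \<gamma> t)" for t y
  \<comment> \<open>The factor \<open>k\<close> is the component of a supporting normal along
    \<open>\<i> * tangent t\<close>; its sign may a priori depend on \<open>t\<close>.\<close>
  have same_sign: "\<exists>k. \<forall>y\<in>D. k * w t y > 0" if t: "t \<in> interior I" for t
  proof -
    have tI: "t \<in> I" using t interior_subset by blast
    have "\<gamma> t \<notin> D" using frontier_eq tI D(2) by (auto simp: frontier_def interior_open)
    then obtain a b where a: "a \<noteq> 0" "a \<bullet> \<gamma> t \<le> b" "\<forall>y\<in>D. a \<bullet> y \<ge> b"
      using separating_hyperplane_sets[of "{\<gamma> t}" D] D(3) assms by auto
    have strict: "a \<bullet> (y - \<gamma> t) > 0" if "y \<in> D" for y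
      using open_half_plane_strict[OF D(2), of "- a" "\<gamma> t" y] a that by (force simp: inner_simps)
    have cl: "a \<bullet> \<gamma> t \<le> a \<bullet> y" if "y \<in> closure D" for y
    proof -
      have "closure D \<subseteq> {y. a \<bullet> y \<ge> a \<bullet> \<gamma> t}"
        using strict by (intro closure_minimal closed_halfspace_ge) (force simp: inner_simps less_imp_le)
      with that show ?thesis by blast
    qed
    have "a \<bullet> tangent t = 0"
    proof -
      obtain d where d: "d > 0" "ball t d \<subseteq> I" using t by (auto simp: mem_interior)
      have "(\<gamma> has_vector_derivative tangent t) (at t)"
        using has_tangent[OF tI] at_within_interior[OF t] by simp
      then have "((\<lambda>s. a \<bullet> \<gamma> s) has_vector_derivative a \<bullet> tangent t) (at t)"
        by (rule bounded_linear.has_vector_derivative[OF bounded_linear_inner_right])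
      then have "DERIV (\<lambda>s. a \<bullet> \<gamma> s) t :> a \<bullet> tangent t"
        by (simp add: has_real_derivative_iff_has_vector_derivative)
      moreover have "\<forall>s. \<bar>t - s\<bar> < d \<longrightarrow> a \<bullet> \<gamma> t \<le> a \<bullet> \<gamma> s"
      proof (intro allI impI cl)
        fix s assume "\<bar>t - s\<bar> < d"
        then have "s \<in> I" using d(2) by (auto simp: dist_real_def)
        then have "\<gamma> s \<in> frontier D" using frontier_eq by blast
        then show "\<gamma> s \<in> closure D" by (simp add: frontier_def)
      qed
      ultimately show ?thesis using d(1) DERIV_local_min by blast
    qed
    \<comment> \<open>Expansion of \<open>a\<close> in the orthogonal basis
      \<open>tangent t\<close>, \<open>\<i> * tangent t\<close>; the first component
      vanishes.\<close>
    moreover have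
      "((Re (tangent t))\<^sup>2 + (Im (tangent t))\<^sup>2) * Re a
        = (a \<bullet> tangent t) * Re (tangent t) - (Im a * Re (tangent t) - Re a * Im (tangent t)) * Im (tangent t)"
      "((Re (tangent t))\<^sup>2 + (Im (tangent t))\<^sup>2) * Im a
        = (a \<bullet> tangent t) * Im (tangent t) + (Im a * Re (tangent t) - Re a * Im (tangent t)) * Re (tangent t)"
      by (simp_all add: inner_complex_def algebra_simps power2_eq_square)
    ultimately have "(norm (tangent t))\<^sup>2 *\<^sub>R a = (a \<bullet> (\<i> * tangent t)) *\<^sub>R (\<i> * tangent t)"
      unfolding cmod_power2 by (simp add: complex_eq_iff inner_complex_def)
    then have "(a \<bullet> (\<i> * tangent t)) * w t y = (norm (tangent t))\<^sup>2 * (a \<bullet> (y - \<gamma> t))" for y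
      unfolding w_def by (metis inner_scaleR_left)
    then show ?thesis using strict tangent_nonzero[OF tI]
      by (intro exI[of _ "a \<bullet> (\<i> * tangent t)"]) simp
  qed
  \<comment> \<open>One sign for all interior parameters: \<open>w t c\<close> is continuous and
    never zero on a connected set.\<close>
  define S where "S = (\<lambda>t. w t c) ` interior I"
  have "connected S"
    unfolding S_def w_def
  proof (intro connected_continuous_image continuous_intros)
    show "continuous_on (interior I) tangent" "continuous_on (interior I) \<gamma>"
      using continuous_on_tangent continuous_on_curve interior_subset continuous_on_subset by blast+
    show "connected (interior I)"
      using I(1) by (simp add: is_interval_convex_1 convex_interior convex_connected)
  qed
  have nz: "0 \<notin> S" using same_sign c by (force simp: S_def)
  obtain t1 where t1: "t1 \<in> interior I" using I(2) by blast
  define \<sigma> where "\<sigma> = - sgn (w t1 c)"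
  have neg_c: "\<sigma> * w t c < 0" if "t \<in> interior I" for t
  proof (rule ccontr)
    assume "\<not> \<sigma> * w t c < 0"
    moreover have "w t c \<in> S" "w t1 c \<in> S" using that t1 by (auto simp: S_def)
    ultimately have "w t c \<le> 0 \<and> 0 \<le> w t1 c \<or> w t1 c \<le> 0 \<and> 0 \<le> w t c"
      by (auto simp: \<sigma>_def sgn_if split: if_splits)
    then have "0 \<in> S"
      using \<open>connected S\<close> \<open>w t c \<in> S\<close> \<open>w t1 c \<in> S\<close> unfolding connected_iff_interval by blast
    then show False using nz by contradiction
  qed
  have neg: "\<sigma> * w t y < 0" if t: "t \<in> interior I" and y: "y \<in> D" for t y
  proof -
    obtain k where k: "\<And>y. y \<in> D \<Longrightarrow> k * w t y > 0" using same_sign[OF t] by blast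
    \<comment> \<open>The factor \<open>k\<close> has a common sign with \<open>w t y\<close> and
      with \<open>w t c\<close>, which transfers the sign at the reference point \<open>c\<close> to
      \<open>y\<close>.\<close>
    have "(\<sigma> * w t c) * ((k * w t y) * (k * w t c)) < 0"
      by (rule mult_neg_pos[OF neg_c[OF t] mult_pos_pos[OF k[OF y] k[OF c]]])
    also have "(\<sigma> * w t c) * ((k * w t y) * (k * w t c)) = (k * w t c)\<^sup>2 * (\<sigma> * w t y)"
      by (simp add: power2_eq_square)
    finally show ?thesis by (simp add: mult_less_0_iff)
  qed
  have \<sigma>: "\<sigma> \<noteq> 0" using neg_c[OF t1] by auto
  have weak: "(\<sigma> *\<^sub>R (\<i> * tangent t)) \<bullet> (y - \<gamma> t) \<le> 0" if t: "t \<in> I" and y: "y \<in> D" for t y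
  proof (cases "t \<in> interior I")
    case True
    then show ?thesis using neg[OF _ y] by (simp add: w_def less_imp_le)
  next
    case False
    have "closure (interior I) = closure I"
      using I by (intro convex_closure_interior) (auto simp: is_interval_convex_1)
    then have "t \<in> closure (interior I)" using t closure_subset by blast
    with False have lim: "t islimpt interior I" by (simp add: closure_def)
    have "continuous_on I (\<lambda>t. \<sigma> * w t y)"
      unfolding w_def by (intro continuous_intros continuous_on_tangent continuous_on_curve)
    then have "((\<lambda>t. \<sigma> * w t y) \<longlongrightarrow> \<sigma> * w t y) (at t within interior I)"
      using t interior_subset by (auto simp: continuous_on_def intro: tendsto_within_subset)
    then have "\<sigma> * w t y \<le> 0"
    proof (rule tendsto_upperbound)
      show "\<forall>\<^sub>F s in at t within interior I. \<sigma> * w s y \<le> 0"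
        using neg[OF _ y] by (auto simp: eventually_at_filter less_imp_le)
      show "at t within interior I \<noteq> bot" using lim by (simp add: trivial_limit_within)
    qed
    then show ?thesis by (simp add: w_def)
  qed
  have "(\<sigma> *\<^sub>R (\<i> * tangent t)) \<bullet> (y - \<gamma> t) < 0" if "t \<in> I" "y \<in> D" for t y
    using that \<sigma> tangent_nonzero by (intro open_half_plane_strict[OF D(2)] weak) auto
  then show ?thesis by blast
qed

text \<open>For compact \<open>I\<close> the parameters accumulate by Bolzano-Weierstrass. For open
  \<open>I\<close> the points of \<open>X\<close> accumulate at some p = \<gamma> s. The curve
  crosses the ray from \<open>c\<close> through \<open>p\<close> transversally at \<open>s\<close>,
  hence it crosses the ray through any nearby point \<open>z\<close> of \<open>X\<close> at a
  parameter near \<open>s\<close>; a ray from \<open>c\<close> meets the frontier only once, so the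
  crossing point is \<open>z\<close>.\<close>

lemma frontier_limit_parameter:
  assumes I_type: "open I \<or> compact I" and X: "X \<subseteq> frontier D" "infinite X"
  shows "\<exists>s\<in>I. s islimpt {t\<in>I. \<gamma> t \<in> X}"
proof -
  define T where "T = {t\<in>I. \<gamma> t \<in> X}"
  have "\<gamma> ` T = X" using X(1) frontier_eq by (auto simp: T_def)
  then have "infinite T" using X(2) by (metis finite_imageI)
  consider "compact I" | "open I" using I_type by blast
  then show ?thesis
  proof cases
    case 1
    have "T \<subseteq> I" by (auto simp: T_def)
    with 1 \<open>infinite T\<close> show ?thesis unfolding compact_eq_Bolzano_Weierstrass T_def by blast
  next
    case 2
    have "compact (frontier D)"
      using D(1) by (simp add: compact_frontier_bounded)
    with X obtain p where p: "p \<in> frontier D" "p islimpt X"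
      unfolding compact_eq_Bolzano_Weierstrass by blast
    obtain s where s: "s \<in> I" "\<gamma> s = p" using p(1) unfolding frontier_eq by auto
    have "D \<noteq> {}" using p(1) by auto
    then obtain c where c: "c \<in> D" by blast
    obtain \<sigma> :: real where "\<And>t y. t \<in> I \<Longrightarrow> y \<in> D \<Longrightarrow> (\<sigma> *\<^sub>R (\<i> * tangent t)) \<bullet> (y - \<gamma> t) < 0"
      using oriented_normal[OF \<open>D \<noteq> {}\<close>] by blast
    from this[OF s(1) c] have "(\<i> * tangent s) \<bullet> (c - p) \<noteq> 0" by (auto simp: s(2))
    \<comment> \<open>The speed at which the curve crosses the line from \<open>c\<close> to
      \<open>p\<close>. It equals \<open>(\<i> * tangent s) \<bullet> (c - p)\<close>, which is
      nonzero because \<open>c\<close> lies strictly on one side of the tangent.\<close>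
    define l where "l = Im (tangent s * cnj (p - c))"
    have l: "l \<noteq> 0" using \<open>(\<i> * tangent s) \<bullet> (c - p) \<noteq> 0\<close>
      by (simp add: l_def inner_complex_def algebra_simps)
    \<comment> \<open>Tells on which side of the line through \<open>c\<close> and \<open>z\<close>
      the point \<gamma> t lies, oriented so that it increases at \<open>s\<close> for z =
      p.\<close>
    define \<psi> where "\<psi> z t = sgn l * Im ((\<gamma> t - c) * cnj (z - c))" for z t
    have "(\<gamma> has_vector_derivative tangent s) (at s)"
      using has_tangent[OF s(1)] at_within_open[OF s(1) 2] by simp
    then have "((\<lambda>t. (\<gamma> t - c) * cnj (p - c)) has_vector_derivative tangent s * cnj (p - c)) (at s)"
      by (auto intro!: derivative_eq_intros)
    then have "((\<lambda>t. Im ((\<gamma> t - c) * cnj (p - c))) has_vector_derivative l) (at s)"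
      unfolding l_def by (rule bounded_linear.has_vector_derivative[OF bounded_linear_Im])
    then have "DERIV (\<psi> p) s :> sgn l * l"
      unfolding \<psi>_def[abs_def]
      by (intro DERIV_cmult) (simp add: has_real_derivative_iff_has_vector_derivative)
    moreover have "sgn l * l > 0" using l by (simp add: sgn_if)
    ultimately obtain d1 d2 where d12: "d1 > 0" "d2 > 0"
      "\<And>h. 0 < h \<Longrightarrow> h < d1 \<Longrightarrow> \<psi> p (s - h) < \<psi> p s" "\<And>h. 0 < h \<Longrightarrow> h < d2 \<Longrightarrow> \<psi> p s < \<psi> p (s + h)"
      using DERIV_pos_inc_left DERIV_pos_inc_right by metis
    have \<psi>_s: "\<psi> p s = 0" by (simp add: \<psi>_def s(2) algebra_simps)
    define R where "R = norm (p - c)"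
    have R: "R > 0" using c p(1) D(2) by (auto simp: R_def frontier_def interior_open)
    have "\<exists>t\<in>T. t \<noteq> s \<and> dist t s < \<delta>" if "\<delta> > 0" for \<delta>
    proof -
      obtain d3 where d3: "d3 > 0" "cball s d3 \<subseteq> I" using 2 s(1) open_contains_cball by blast
      obtain d4 where d4: "d4 > 0" "\<And>t. t \<in> I \<Longrightarrow> dist t s < d4 \<Longrightarrow> dist (\<gamma> t) p < R / 4"
        using continuous_on_curve s R unfolding continuous_on_iff
        by (metis zero_less_divide_iff zero_less_numeral)
      \<comment> \<open>The half makes all bounds strict: \<open>d1\<close> and \<open>d2\<close>
        give opposite signs at \<open>s - h\<close> and \<open>s + h\<close>, \<open>d3\<close>
        stays inside \<open>I\<close>, and \<open>d4\<close> keeps the curve close to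
        \<open>p\<close>.\<close>
      define h where "h = min (min (min d1 d2) (min d3 d4)) \<delta> / 2"
      have h: "h > 0" "h < d1" "h < d2" "h < d3" "h < d4" "h < \<delta>"
      proof -
        have "2 * h \<le> d1" "2 * h \<le> d2" "2 * h \<le> d3" "2 * h \<le> d4" "2 * h \<le> \<delta>"
          by (simp_all add: h_def min_le_iff_disj)
        moreover show "h > 0" using d12 d3 d4 that by (simp add: h_def)
        ultimately show "h < d1" "h < d2" "h < d3" "h < d4" "h < \<delta>" by simp_all
      qed
      \<comment> \<open>With \<open>h\<close> fixed, the strict signs at \<open>s - h\<close> and
        \<open>s + h\<close> persist for \<open>z\<close> near \<open>p\<close>, so the curve meets
        the line through \<open>c\<close> and \<open>z\<close> between them.\<close>
      have "((\<lambda>z. \<psi> z t) \<longlongrightarrow> \<psi> p t) (at p)" for t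
        unfolding \<psi>_def by (intro tendsto_intros)
      from order_tendstoD(2)[OF this, of "s - h" 0] order_tendstoD(1)[OF this, of 0 "s + h"]
      have "\<forall>\<^sub>F z in at p. \<psi> z (s - h) < 0" "\<forall>\<^sub>F z in at p. 0 < \<psi> z (s + h)"
        using d12(3,4)[of h] h \<psi>_s by auto
      moreover have "\<forall>\<^sub>F z in at p. z \<in> ball p (R / 4)"
        using R by (intro eventually_at_in_open') auto
      moreover have "\<forall>\<^sub>F z in at p. z \<noteq> p" by (simp add: eventually_at_filter)
      ultimately have "\<forall>\<^sub>F z in at p. \<psi> z (s - h) < 0 \<and> 0 < \<psi> z (s + h) \<and> dist p z < R / 4 \<and> z \<noteq> p"
        by eventually_elim simp
      moreover have "\<exists>\<^sub>F z in at p. z \<in> X" using p(2) by (simp add: islimpt_conv_frequently_at)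
      ultimately have "\<exists>\<^sub>F z in at p. z \<in> X \<and> \<psi> z (s - h) < 0 \<and> 0 < \<psi> z (s + h) \<and> dist p z < R / 4 \<and> z \<noteq> p"
        by (rule frequently_eventually_frequently[rotated])
      then obtain z where z: "z \<noteq> p" "z \<in> X" "\<psi> z (s - h) < 0" "0 < \<psi> z (s + h)" "dist p z < R / 4"
        by (blast dest: frequently_ex)
      have sub: "{s - h..s + h} \<subseteq> I" using d3(2) h by (auto simp: subset_eq dist_real_def)
      have "continuous_on {s - h..s + h} (\<psi> z)"
        unfolding \<psi>_def[abs_def] by (intro continuous_intros continuous_on_subset[OF continuous_on_curve sub])
      then obtain t where t: "s - h \<le> t" "t \<le> s + h" "\<psi> z t = 0"
        using IVT'[of "\<psi> z" "s - h" 0 "s + h"] z h by auto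
      have tI: "t \<in> I" using sub t by auto
      have ds: "dist t s < d4" "dist t s < \<delta>" using t h by (auto simp: dist_real_def)
      have "\<gamma> t = z"
      proof (rule frontier_ray_unique[OF D(3,2) c])
        show "\<gamma> t \<in> frontier D" "z \<in> frontier D" using tI frontier_eq z(2) X(1) by auto
        show "Im ((\<gamma> t - c) * cnj (z - c)) = 0" using t(3) l by (simp add: \<psi>_def sgn_zero_iff)
        \<comment> \<open>It remains to exclude the opposite ray. Deviations below R / 4 change the
          inner product \<open>R\<^sup>2\<close> by at most 9/16 of it.\<close>
        define u v where "u = \<gamma> t - p" and "v = z - p"
        have uv: "norm u < R / 4" "norm v < R / 4"
          using d4(2)[OF tI ds(1)] z(5) by (auto simp: u_def v_def dist_norm norm_minus_commute)
        have "(\<gamma> t - c) \<bullet> (z - c) = (p - c + u) \<bullet> (p - c + v)" by (simp add: u_def v_def)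
        also have "\<dots> = R\<^sup>2 + (p - c) \<bullet> u + (p - c) \<bullet> v + u \<bullet> v"
          by (simp add: inner_add_left inner_add_right inner_commute R_def power2_norm_eq_inner)
        also have "\<dots> \<ge> R\<^sup>2 - R * (R / 4) - R * (R / 4) - (R / 4) * (R / 4)"
        proof -
          have CS: "\<bar>x \<bullet> y\<bar> \<le> A * B" if "norm x \<le> A" "norm y \<le> B" for x y :: complex and A B
            using that by (intro order_trans[OF Cauchy_Schwarz_ineq2] mult_mono') auto
          have "\<bar>(p - c) \<bullet> u\<bar> \<le> R * (R / 4)" "\<bar>(p - c) \<bullet> v\<bar> \<le> R * (R / 4)" "\<bar>u \<bullet> v\<bar> \<le> (R / 4) * (R / 4)"
            using uv by (intro CS; simp add: R_def)+
          then show ?thesis by linarith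
        qed
        also have "R\<^sup>2 - R * (R / 4) - R * (R / 4) - (R / 4) * (R / 4) = 7 / 16 * R\<^sup>2"
          by (simp add: power2_eq_square)
        finally have "(\<gamma> t - c) \<bullet> (z - c) > 0" using R by (smt (verit) zero_less_power mult_pos_pos divide_pos_pos zero_less_numeral)
        then show "Re ((\<gamma> t - c) * cnj (z - c)) > 0" by (simp add: inner_complex_def algebra_simps)
      qed
      then show ?thesis using tI z s(2) ds by (intro bexI[of _ t]) (auto simp: T_def)
    qed
    then have "s islimpt T" unfolding islimpt_approachable by blast
    then show ?thesis using s(1) unfolding T_def by blast
  qed
qed

text \<open>Krein-Milman for the compact convex closure. It shows that the frontier cannot lie on
  one line, and it later lifts an inclusion of the frontier into a convex set to all of
  \<open>closure D\<close>.\<close>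

lemma closure_subset_hull_frontier: "closure D \<subseteq> convex hull frontier D"
proof -
  have "closure D = convex hull (frontier (closure D))"
    using D by (intro Krein_Milman_frontier) (auto simp: compact_closure convex_closure)
  moreover have "interior D \<subseteq> interior (closure D)" by (intro interior_mono closure_subset)
  then have "frontier (closure D) \<subseteq> frontier D" by (auto simp: frontier_def)
  ultimately show ?thesis using hull_mono by metis
qed

text \<open>A further common point of the closure and a supporting line would yield a segment on the
  boundary, so by analyticity the whole curve would lie on the line.\<close>

lemma strictly_convex:
  assumes I_type: "open I \<or> compact I" and n: "\<And>z. z \<in> D \<Longrightarrow> n \<bullet> (z - \<gamma> t) < 0"
    and t: "t \<in> I" and y: "y \<in> closure D" "n \<bullet> (y - \<gamma> t) = 0"
  shows "y = \<gamma> t"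
proof (rule ccontr)
  define p where "p = \<gamma> t"
  define f where "f z = n \<bullet> (z - p)" for z
  assume ne: "y \<noteq> \<gamma> t"
  have "p \<in> frontier D" using t frontier_eq by (auto simp: p_def)
  then have p: "p \<in> closure D" "D \<noteq> {}" by (auto simp: frontier_def)
  define X where "X = closed_segment p y"
  have fX: "f z = 0" if z: "z \<in> X" for z
  proof -
    obtain u where "z = (1 - u) *\<^sub>R p + u *\<^sub>R y" using z unfolding X_def in_segment by blast
    then have "z - p = u *\<^sub>R (y - p)" by (simp add: algebra_simps)
    then show ?thesis using y(2) by (simp add: f_def) (simp add: p_def)
  qed
  have "X \<subseteq> closure D"
    unfolding X_def using p(1) y(1) D(3) by (intro closed_segment_subset convex_closure)
  moreover have "X \<inter> D = {}" using fX n by (force simp: f_def p_def)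
  ultimately have "X \<subseteq> frontier D" using D(2) by (auto simp: frontier_def interior_open)
  moreover have "infinite X" using ne by (simp add: X_def p_def)
  ultimately obtain s where s: "s \<in> I" "s islimpt {t\<in>I. \<gamma> t \<in> X}"
    using frontier_limit_parameter[OF I_type] by blast
  define Z where "Z = {t\<in>I. f (\<gamma> t) = 0}"
  have "s islimpt Z" using s(2) by (rule islimpt_subset) (auto simp: Z_def fX)
  have "I \<subseteq> Z"
  proof (rule limit_point_propagation[OF I s(1) \<open>s islimpt Z\<close>])
    fix t\<^sub>0 assume t0: "t\<^sub>0 \<in> I" "t\<^sub>0 islimpt Z"
    obtain r G where r: "r > 0" and G: "G holomorphic_on ball (of_real t\<^sub>0) r"
      and eq: "\<And>t. t \<in> I \<Longrightarrow> \<bar>t - t\<^sub>0\<bar> < r \<Longrightarrow> G (of_real t) = \<gamma> t"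
      using holomorphic_extension[OF t0(1)] by blast
    obtain U V where UV: "U holomorphic_on ball (of_real t\<^sub>0) r" "V holomorphic_on ball (of_real t\<^sub>0) r"
      "\<And>t. U (of_real t) = of_real (Re (G (of_real t)))" "\<And>t. V (of_real t) = of_real (Im (G (of_real t)))"
      using holomorphic_Re_Im_extension[OF G] by blast
    \<comment> \<open>The inner product \<open>f (\<gamma> t)\<close> continued to complex
      parameters.\<close>
    define F where "F z = of_real (Re n) * (U z - of_real (Re p)) + of_real (Im n) * (V z - of_real (Im p))" for z
    have F: "F holomorphic_on ball (of_real t\<^sub>0) r"
      unfolding F_def[abs_def] by (intro holomorphic_intros UV)
    have F_eq: "F (of_real t) = of_real (f (\<gamma> t))" if "t \<in> I" "\<bar>t - t\<^sub>0\<bar> < r" for t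
      using eq[OF that] by (simp add: F_def UV f_def inner_complex_def)
    have "t \<in> Z" if t: "t \<in> I" "\<bar>t - t\<^sub>0\<bar> < r" for t
    proof -
      have "F (of_real t) = 0"
        by (rule analytic_zero_propagation[OF F r t0(2) _ t(2)]) (use F_eq in \<open>auto simp: Z_def\<close>)
      then show ?thesis using F_eq[OF t] t(1) by (simp add: Z_def)
    qed
    then show "\<exists>\<epsilon>>0. \<forall>t\<in>I. \<bar>t - t\<^sub>0\<bar> < \<epsilon> \<longrightarrow> t \<in> Z" using r by blast
  qed
  then have "frontier D \<subseteq> {z. n \<bullet> z = n \<bullet> p}"
    unfolding frontier_eq by (auto simp: Z_def f_def inner_diff_right)
  then have "convex hull frontier D \<subseteq> {z. n \<bullet> z = n \<bullet> p}"
    by (intro hull_minimal convex_hyperplane)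
  then have "D \<subseteq> {z. n \<bullet> z = n \<bullet> p}"
    using closure_subset_hull_frontier closure_subset by blast
  then show False using n p(2) by (force simp: p_def inner_diff_right)
qed

end

subsection \<open>Convexity of the numerical range\<close>

lemma Rayleigh_quotient_in_numerical_range:
  assumes A: "bounded_clinear A" and x: "x \<noteq> 0"
  shows "cinner (A x) x / of_real ((norm x)\<^sup>2) \<in> numerical_range A"
  unfolding numerical_range_def
proof (rule image_eqI)
  show "(1 / norm x) *\<^sub>R x \<in> sphere 0 1" using x by simp
  show "cinner (A x) x / of_real ((norm x)\<^sup>2) = cinner (A ((1 / norm x) *\<^sub>R x)) ((1 / norm x) *\<^sub>R x)"
    by (simp add: bounded_clinear_simps[OF A] cinner_simps power2_eq_square)
qed

text \<open>Toeplitz--Hausdorff: after multiplying \<open>x\<close> by a phase, the normalized quadratic form is real on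
  the segment from \<open>x\<close> to \<open>y\<close>, and the intermediate value theorem applies.\<close>

lemma convex_numerical_range:
  fixes A :: "'a::complex_hilbert \<Rightarrow> 'a"
  assumes A: "bounded_clinear A"
  shows "convex (numerical_range A)"
  unfolding convex_alt
proof (intro ballI allI impI)
  fix z1 z2 :: complex and u :: real
  assume z: "z1 \<in> numerical_range A" "z2 \<in> numerical_range A" and u: "0 \<le> u \<and> u \<le> 1"
  show "(1 - u) *\<^sub>R z1 + u *\<^sub>R z2 \<in> numerical_range A"
  proof (cases "z1 = z2")
    case True
    then show ?thesis using z by (simp add: algebra_simps)
  next
    case False
    obtain x0 y where x0: "norm x0 = 1" "z1 = cinner (A x0) x0" and y: "norm y = 1" "z2 = cinner (A y) y"
      using z by (auto simp: numerical_range_def)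
    \<comment> \<open>The affine normalization that sends \<open>z1\<close> to 0 and
      \<open>z2\<close> to 1.\<close>
    define g where "g v w = (cinner (A v) w - z1 * cinner v w) / (z2 - z1)" for v w
    \<comment> \<open>For \<open>x = c *\<^sub>C x0\<close> the sum of the cross terms has imaginary
      part \<open>Im (c * \<beta>)\<close>, so the phase \<open>c\<close> is chosen to make
      \<open>c * \<beta>\<close> real.\<close>
    define \<beta> where "\<beta> = g x0 y - cnj (g y x0)"
    define c where "c = (if \<beta> = 0 then 1 else cnj \<beta> / norm \<beta>)"
    have c: "norm c = 1" by (simp add: c_def norm_divide)
    have "Im (c * \<beta>) = 0"
      by (simp add: c_def complex_norm_square[symmetric] mult.commute[of "cnj \<beta>"] flip: of_real_power of_real_divide)
    define x where "x = c *\<^sub>C x0"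
    have g_lin: "g (v + w) t = g v t + g w t" "g t (v + w) = g t v + g t w"
      "g (k *\<^sub>R v) w = of_real k * g v w" "g v (k *\<^sub>R w) = of_real k * g v w"
      "g (d *\<^sub>C v) w = d * g v w" "g v (d *\<^sub>C w) = cnj d * g v w" for v w t k d
      by (simp_all add: g_def bounded_clinear_simps[OF A] cinner_simps field_simps add_divide_distrib diff_divide_distrib)
    have "norm x = 1" using c x0 by (simp add: x_def norm_scaleC)
    have "g x0 x0 = 0" using x0 by (simp add: g_def cinner_self)
    then have gx: "g x x = 0" by (simp add: x_def g_lin)
    have gy: "g y y = 1" using y False by (simp add: g_def cinner_self)
    define \<kappa> where "\<kappa> = Re (g x y + g y x)"
    have "Im (g x y + g y x) = Im (c * \<beta>)"
      by (simp add: x_def g_lin \<beta>_def algebra_simps)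
    then have \<kappa>: "g x y + g y x = of_real \<kappa>"
      using \<open>Im (c * \<beta>) = 0\<close> by (simp add: \<kappa>_def complex_eq_iff)
    define v where "v s = (1 - s) *\<^sub>R x + s *\<^sub>R y" for s
    have gv: "g (v s) (v s) = of_real (s\<^sup>2 + (1 - s) * s * \<kappa>)" for s
    proof -
      have "g (v s) (v s) = of_real ((1 - s) * s) * (g x y + g y x) + of_real (s\<^sup>2)"
        unfolding v_def g_lin by (simp add: gx gy power2_eq_square algebra_simps)
      then show ?thesis by (simp add: \<kappa>)
    qed
    \<comment> \<open>As both vectors have norm 1, a zero forces s = 1/2 and x = - y. The normalized
      values at \<open>x\<close> and \<open>y\<close> would then coincide, although they are 0 and
      1.\<close>
    have nz: "v s \<noteq> 0" for s
    proof
      assume v0: "v s = 0"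
      then have "(1 - s) *\<^sub>R x = (- s) *\<^sub>R y" by (simp add: v_def eq_neg_iff_add_eq_0)
      then have "norm ((1 - s) *\<^sub>R x) = norm ((- s) *\<^sub>R y)" by (rule arg_cong)
      then have s: "s = 1/2" using \<open>norm x = 1\<close> y(1) by auto
      have "g (v s) y = 0" "g x (v s) = 0" unfolding v0 by (simp_all add: g_def bounded_clinear_simps[OF A] cinner_simps)
      then have "g x y = - 1" "g x y = 0"
        unfolding v_def s by (simp_all add: g_lin gx gy add_eq_0_iff)
      then show False by simp
    qed
    define \<rho> where "\<rho> s = (s\<^sup>2 + (1 - s) * s * \<kappa>) / (norm (v s))\<^sup>2" for s
    have "continuous_on {0..1} \<rho>"
      unfolding \<rho>_def v_def using nz[unfolded v_def] by (intro continuous_intros) auto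
    moreover have "\<rho> 0 = 0" "\<rho> 1 = 1" using y by (simp_all add: \<rho>_def v_def)
    ultimately obtain s where s: "\<rho> s = u"
      using IVT'[of \<rho> 0 u 1] u by auto
    have n0: "of_real ((norm (v s))\<^sup>2) \<noteq> (0::complex)" using nz[of s] by simp
    have "g (v s) (v s) / of_real ((norm (v s))\<^sup>2) = of_real u"
      unfolding s[symmetric] \<rho>_def gv by simp
    then have "cinner (A (v s)) (v s) / of_real ((norm (v s))\<^sup>2) - z1 = of_real u * (z2 - z1)"
      using False n0 unfolding g_def cinner_self by (simp add: field_simps)
    then have "cinner (A (v s)) (v s) / of_real ((norm (v s))\<^sup>2) = (1 - u) *\<^sub>R z1 + u *\<^sub>R z2"
      by (simp add: scaleR_conv_of_real algebra_simps)
    then show ?thesis using Rayleigh_quotient_in_numerical_range[OF A nz[of s]] by simp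
  qed
qed

subsection \<open>Supporting forms of the numerical range\<close>

definition re_form :: "('a::complex_hilbert \<Rightarrow> 'a) \<Rightarrow> 'a \<Rightarrow> 'a \<Rightarrow> complex"
  where "re_form A x y = (cinner (A x) y + cnj (cinner (A y) x)) / 2"

definition im_form :: "('a::complex_hilbert \<Rightarrow> 'a) \<Rightarrow> 'a \<Rightarrow> 'a \<Rightarrow> complex"
  where "im_form A x y = (cinner (A x) y - cnj (cinner (A y) x)) / (2 * \<i>)"

lemma re_im_form_self:
  "re_form A x x = of_real (Re (cinner (A x) x))" "im_form A x x = of_real (Im (cinner (A x) x))"
  by (simp_all add: re_form_def im_form_def complex_eq_iff)

lemma hermitian_re_im_form:
  assumes A: "bounded_clinear A"
  shows "hermitian_form (re_form A)" "hermitian_form (im_form A)"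
proof -
  obtain B where B: "\<And>x. norm (A x) \<le> norm x * B"
    using A bounded_linear.bounded[of A] by (auto simp: bounded_clinear_def)
  have AB: "norm (cinner (A x) y) \<le> B * norm x * norm y" for x y
    using norm_cinner_le[of "A x" y] mult_right_mono[OF B, of "norm y" x] by (simp add: mult_ac)
  have bd: "norm (cinner (A x) y) + norm (cinner (A y) x) \<le> 2 * (B * norm x * norm y)" for x y
    using AB[of x y] AB[of y x] by (simp add: mult_ac)
  show "hermitian_form (re_form A)"
  proof (rule hermitian_formI[of _ B])
    show "norm (re_form A x y) \<le> B * norm x * norm y" for x y
      using norm_triangle_ineq[of "cinner (A x) y" "cnj (cinner (A y) x)"] bd[of x y]
      by (simp add: re_form_def norm_divide)
  qed (simp_all add: re_form_def bounded_clinear_simps[OF A] cinner_simps field_simps)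
  show "hermitian_form (im_form A)"
  proof (rule hermitian_formI[of _ B])
    show "norm (im_form A x y) \<le> B * norm x * norm y" for x y
      using norm_triangle_ineq4[of "cinner (A x) y" "cnj (cinner (A y) x)"] bd[of x y]
      by (simp add: im_form_def norm_divide norm_mult)
  qed (simp_all add: im_form_def bounded_clinear_simps[OF A] cinner_simps field_simps)
qed

lemma (in analytic_convex_domain) numerical_range_eq_closure:
  fixes A :: "'a::complex_hilbert \<Rightarrow> 'a"
  assumes I_type: "open I \<or> compact I" and A: "bounded_clinear A"
    and WD: "numerical_range A \<subseteq> closure D" and ess: "essential_numerical_range A \<subseteq> D"
    and inf: "infinite (closure (numerical_range A) \<inter> frontier D)"
  shows "numerical_range A = closure D"
proof -
  have "D \<noteq> {}" using inf by auto
  then obtain \<sigma> where \<sigma>: "\<And>t y. t \<in> I \<Longrightarrow> y \<in> D \<Longrightarrow> (\<sigma> *\<^sub>R (\<i> * tangent t)) \<bullet> (y - \<gamma> t) < 0"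
    using oriented_normal by blast
  define n where "n t = \<sigma> *\<^sub>R (\<i> * tangent t)" for t
  have n_less: "n t \<bullet> (y - \<gamma> t) < 0" if "t \<in> I" "y \<in> D" for t y
    using \<sigma>[OF that] by (simp add: n_def)
  have n_le: "n t \<bullet> (y - \<gamma> t) \<le> 0" if "t \<in> I" "y \<in> closure D" for t y
  proof -
    have "closure D \<subseteq> {y. n t \<bullet> y \<le> n t \<bullet> \<gamma> t}"
      using n_less[OF that(1)]
      by (intro closure_minimal closed_halfspace_le) (force simp: inner_diff_right intro: less_imp_le)
    then show ?thesis using that(2) by (auto simp: inner_diff_right)
  qed
  \<comment> \<open>Three fixed forms carry all dependence on the vectors: expanding the real inner
    product with \<open>n t\<close> leaves only the scalar coefficients \<open>c i t\<close>
    depending on \<open>t\<close>, as \<open>analytic_form_family_kernel\<close> requires.\<close>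
  define h where "h i = (if i = 0 then re_form A else if i = 1 then im_form A else cinner)" for i :: nat
  define c where "c i t = (if i = 0 then Re (n t) else if i = 1 then Im (n t) else - (n t \<bullet> \<gamma> t))" for i :: nat and t
  define b where "b t x y = (\<Sum>i<3. of_real (c i t) * h i x y)" for t x y
  have h: "hermitian_form (h i)" for i
    using hermitian_re_im_form[OF A] hermitian_form_cinner[where 'a = 'a] by (simp add: h_def)
  have b: "hermitian_form (b t)" for t
    unfolding b_def by (intro hermitian_form_sum hermitian_form_of_real_mult h)
  have b_self: "Re (b t x x) = n t \<bullet> (cinner (A x) x - of_real ((norm x)\<^sup>2) * \<gamma> t)" for t x
    by (simp add: b_def c_def h_def re_im_form_self cinner_self numeral_3_eq_3 inner_complex_def algebra_simps
        del: of_real_power)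
  have b_Rayleigh: "Re (b t x x) = (norm x)\<^sup>2 * (n t \<bullet> (cinner (A x) x / of_real ((norm x)\<^sup>2) - \<gamma> t))"
    if "x \<noteq> 0" for t x
  proof -
    have "cinner (A x) x - of_real ((norm x)\<^sup>2) * \<gamma> t
        = (norm x)\<^sup>2 *\<^sub>R (cinner (A x) x / of_real ((norm x)\<^sup>2) - \<gamma> t)"
      using that by (simp add: scaleR_conv_of_real field_simps)
    then show ?thesis unfolding b_self by simp
  qed
  have b_neg: "Re (b t x x) \<le> 0" if t: "t \<in> I" for t x
  proof (cases "x = 0")
    case True
    then show ?thesis by (simp add: hermitian_form_zero_left[OF b])
  next
    case False
    then show ?thesis
      unfolding b_Rayleigh[OF False]
      using n_le[OF t] Rayleigh_quotient_in_numerical_range[OF A False] WD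
      by (intro mult_nonneg_nonpos) auto
  qed
  have coercive: "\<exists>(m::nat) e M. M > 0 \<and> (\<exists>\<kappa>>0. \<forall>x. \<kappa> * (norm x)\<^sup>2
      \<le> M * (\<Sum>l<m. (norm (cinner x (e l)))\<^sup>2) - Re (b t x x))" if t: "t \<in> I" for t
  proof -
    have "n t \<bullet> (z - \<gamma> t) < 0" if "z \<in> essential_numerical_range A" for z
      using that ess by (intro n_less t) auto
    from essential_numerical_range_half_plane[OF A this, folded b_self]
    obtain m e \<delta> where \<delta>: "\<delta> > 0" and e: "orthonormal_upto m e"
      and neg: "\<forall>x. (\<forall>i<m. cinner x (e i) = 0) \<longrightarrow> Re (b t x x) \<le> - \<delta> * (norm x)\<^sup>2"
      by blast
    have "\<exists>M>0. \<exists>\<kappa>>0. \<forall>x. \<kappa> * (norm x)\<^sup>2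
        \<le> M * (\<Sum>l<m. (norm (cinner x (e l)))\<^sup>2) - Re (b t x x)"
      by (rule form_coercive_modulo_finite_rank[OF b b_neg[OF t] e \<delta>]) (use neg in blast)
    then show ?thesis by (intro exI[of _ m] exI[of _ e])
  qed
  define Z where "Z = {t\<in>I. \<exists>x. x \<noteq> 0 \<and> Re (b t x x) = 0}"
  have attained: "t \<in> Z" if t: "t \<in> I" and cl: "\<gamma> t \<in> closure (numerical_range A)" for t
  proof -
    obtain w where "\<And>k. w k \<in> numerical_range A" and w: "w \<longlonglongrightarrow> \<gamma> t"
      using cl unfolding closure_sequential by blast
    then have "\<forall>k. \<exists>x. norm x = 1 \<and> w k = cinner (A x) x"
      by (fastforce simp: numerical_range_def)
    then obtain X where X: "\<And>k. norm (X k) = 1" "\<And>k. w k = cinner (A (X k)) (X k)" by metis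
    have "(\<lambda>k. n t \<bullet> (w k - \<gamma> t)) \<longlonglongrightarrow> n t \<bullet> (\<gamma> t - \<gamma> t)" by (intro tendsto_intros w)
    then have lim: "(\<lambda>k. Re (b t (X k) (X k))) \<longlonglongrightarrow> 0" by (simp add: b_self X)
    obtain m :: nat and e M \<kappa> where "M > 0" "\<kappa> > 0"
      "\<And>x. \<kappa> * (norm x)\<^sup>2 \<le> M * (\<Sum>l<m. (norm (cinner x (e l)))\<^sup>2) - Re (b t x x)"
      using coercive[OF t] by blast
    then have "\<exists>x. norm x = 1 \<and> Re (b t x x) = 0"
      by (intro coercive_maximum_attained[OF b b_neg[OF t] _ _ _ X(1) lim])
    then show ?thesis using t by (force simp: Z_def)
  qed
  obtain s where s: "s \<in> I" "s islimpt {t\<in>I. \<gamma> t \<in> closure (numerical_range A) \<inter> frontier D}"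
    using frontier_limit_parameter[OF I_type _ inf] by auto
  have "s islimpt Z" using s(2) by (rule islimpt_subset) (auto intro: attained)
  have "I \<subseteq> Z"
  proof (rule limit_point_propagation[OF I s(1) \<open>s islimpt Z\<close>])
    fix t\<^sub>0 assume t0: "t\<^sub>0 \<in> I" and lim: "t\<^sub>0 islimpt Z"
    obtain m :: nat and e M \<kappa> where \<kappa>: "\<kappa> > 0"
      and co: "\<And>x. \<kappa> * (norm x)\<^sup>2 \<le> M * (\<Sum>l<m. (norm (cinner x (e l)))\<^sup>2) - Re (b t\<^sub>0 x x)"
      using coercive[OF t0] by blast
    obtain r G where r: "r > 0" and G: "G holomorphic_on ball (of_real t\<^sub>0) r"
      and G_eq: "\<And>t. t \<in> I \<Longrightarrow> \<bar>t - t\<^sub>0\<bar> < r \<Longrightarrow> G (of_real t) = \<gamma> t"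
        "\<And>t. t \<in> I \<Longrightarrow> \<bar>t - t\<^sub>0\<bar> < r \<Longrightarrow> deriv G (of_real t) = tangent t"
      using holomorphic_extension[OF t0] by blast
    have G': "deriv G holomorphic_on ball (of_real t\<^sub>0) r" by (intro holomorphic_deriv G) simp
    obtain U V where UV: "U holomorphic_on ball (of_real t\<^sub>0) r" "V holomorphic_on ball (of_real t\<^sub>0) r"
      "\<And>t. U (of_real t) = of_real (Re (G (of_real t)))" "\<And>t. V (of_real t) = of_real (Im (G (of_real t)))"
      using holomorphic_Re_Im_extension[OF G] by blast
    obtain U' V' where UV': "U' holomorphic_on ball (of_real t\<^sub>0) r" "V' holomorphic_on ball (of_real t\<^sub>0) r"
      "\<And>t. U' (of_real t) = of_real (Re (deriv G (of_real t)))"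
      "\<And>t. V' (of_real t) = of_real (Im (deriv G (of_real t)))"
      using holomorphic_Re_Im_extension[OF G'] by blast
    \<comment> \<open>The coefficients \<open>c i\<close> for complex parameters: \<open>n t\<close>
      has real part \<open>- \<sigma> * Im (tangent t)\<close> and imaginary part
      \<open>\<sigma> * Re (tangent t)\<close>, and the last case is minus its inner product with
      the curve.\<close>
    define F where "F i z = (if i = 0 then - (of_real \<sigma> * V' z) else if i = 1 then of_real \<sigma> * U' z
      else of_real \<sigma> * V' z * U z - of_real \<sigma> * U' z * V z)" for i :: nat and z
    have F: "F i holomorphic_on ball (of_real t\<^sub>0) r" for i
    proof -
      have "(\<lambda>z. - (of_real \<sigma> * V' z)) holomorphic_on ball (of_real t\<^sub>0) r"
        "(\<lambda>z. of_real \<sigma> * U' z) holomorphic_on ball (of_real t\<^sub>0) r"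
        "(\<lambda>z. of_real \<sigma> * V' z * U z - of_real \<sigma> * U' z * V z) holomorphic_on ball (of_real t\<^sub>0) r"
        by (intro holomorphic_intros UV UV')+
      then show ?thesis unfolding F_def[abs_def] by (cases "i = 0"; cases "i = 1") simp_all
    qed
    have Fc: "F i (of_real t) = of_real (c i t)" if "t \<in> I" "\<bar>t - t\<^sub>0\<bar> < r" for i t
      by (simp add: F_def c_def n_def UV UV' G_eq[OF that] inner_complex_def algebra_simps)
    obtain \<epsilon> d where \<epsilon>: "\<epsilon> > 0" and d: "d holomorphic_on ball (of_real t\<^sub>0) \<epsilon>"
      and dZ: "\<And>t. t \<in> I \<Longrightarrow> \<bar>t - t\<^sub>0\<bar> < \<epsilon> \<Longrightarrow> d (of_real t) = 0 \<longleftrightarrow> (\<exists>x. x \<noteq> 0 \<and> Re (b t x x) = 0)"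
      using analytic_form_family_kernel[where J = "{..<3}" and h = h and c = c and F = F and I = I,
          folded b_def, OF _ h r F Fc t0 b_neg \<kappa> co]
      by auto
    have "t \<in> Z" if t: "t \<in> I" "\<bar>t - t\<^sub>0\<bar> < \<epsilon>" for t
    proof -
      have "d (of_real t) = 0"
        by (rule analytic_zero_propagation[OF d \<epsilon> lim _ t(2)]) (auto simp: Z_def dZ)
      then show ?thesis using dZ[OF t] t(1) by (simp add: Z_def)
    qed
    then show "\<exists>\<epsilon>>0. \<forall>t\<in>I. \<bar>t - t\<^sub>0\<bar> < \<epsilon> \<longrightarrow> t \<in> Z" using \<epsilon> by blast
  qed
  have "frontier D \<subseteq> numerical_range A"
  proof
    fix p assume "p \<in> frontier D"
    then obtain t where t: "t \<in> I" "p = \<gamma> t" unfolding frontier_eq by auto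
    then obtain x where x: "x \<noteq> 0" "Re (b t x x) = 0" using \<open>I \<subseteq> Z\<close> by (auto simp: Z_def)
    define z where "z = cinner (A x) x / of_real ((norm x)\<^sup>2)"
    have z: "z \<in> numerical_range A"
      unfolding z_def by (rule Rayleigh_quotient_in_numerical_range[OF A x(1)])
    have "n t \<bullet> (z - \<gamma> t) = 0" using x b_Rayleigh[OF x(1), of t] by (simp add: z_def)
    with z WD have "z = \<gamma> t" by (intro strictly_convex[OF I_type n_less[OF t(1)] t(1)]) auto
    with z t(2) show "p \<in> numerical_range A" by simp
  qed
  then have "convex hull frontier D \<subseteq> numerical_range A"
    by (intro hull_minimal convex_numerical_range A)
  with closure_subset_hull_frontier WD show ?thesis by blast
qed

theorem corollary1p4:
  fixes A :: "'a::complex_hilbert \<Rightarrow> 'a" and D :: "complex set"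
  assumes "bounded D" and "open D" and "convex D"
    and "regular_analytic_curve (frontier D)"
    and "bounded_clinear A"
    and "numerical_range A \<subseteq> closure D"
    and "essential_numerical_range A \<subseteq> D"
    and "infinite (closure (numerical_range A) \<inter> frontier D)"
  shows "numerical_range A = closure D"
proof -
  obtain I \<gamma> where "is_interval I" "interior I \<noteq> {}" and I_type: "open I \<or> compact I"
    and "real_analytic_on \<gamma> I" "\<And>t. t \<in> I \<Longrightarrow> vector_derivative \<gamma> (at t within I) \<noteq> 0"
    and "frontier D = \<gamma> ` I"
    using assms(4) unfolding regular_analytic_curve_def by blast
  then interpret analytic_convex_domain D I \<gamma>
    using assms(1-3) by unfold_locales auto
  show ?thesis
    by (rule numerical_range_eq_closure[OF I_type assms(5-8)])
qed

end
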